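(* (In $\mathbf{ZF}$.) The following conditions are all equivalent: (i) $\mathbf{BPI}$; (ii) for every zero-dimensional $T_1$-space $\mathbf{X}$, the Banaschewski compactification $\beta_0\mathbf{X}$ exists; (iii) for every infinite set $J$, the Banaschewski compactification of the Cantor cube $\mathbf{2}^J$ exists; (iv) for every infinite set $X$, the Banaschewski compactification of the discrete space $X_{disc}=\langle X,\mathcal{P}(X)\rangle$ exists.
   Context: The base theory is $\mathbf{ZF}$ (the Axiom of Choice is not assumed). $\mathbf{BPI}$ (the Boolean Prime Ideal Theorem) is the statement that every Boolean algebra has a prime ideal. A set is infinite if it is not equipotent to any element of $\omega$. A space is zero-dimensional if its clopen subsets form a base. A space is compact if every open cover has a finite subcover. $\mathbf{2}$ is the discrete space $\{0,1\}$ and $\mathbf{2}^J$ carries the product topology. A compactification of $\mathbf{X}$ is a pair $\langle\alpha\mathbf{X},\alpha\rangle$ where $\alpha\mathbf{X}$ is compact and $\alpha:\mathbf{X}\to\alpha\mathbf{X}$ is a homeomorphic embedding with dense image. A Banaschewski compactification of a zero-dimensional $T_1$-space $\mathbf{X}$ is a zero-dimensional $T_1$-compactification $\beta_0\mathbf{X}$ of $\mathbf{X}$ such that for every compact zero-dimensional $T_1$-space $\mathbf{K}$ and every continuous $f:\mathbf{X}\to\mathbf{K}$ there is a continuous $\tilde f:\beta_0\mathbf{X}\to\mathbf{K}$ with $\tilde f\circ\beta_0=f$. *)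

theory Defs
  imports Main
begin

text \<open>
  Since HOL has the axiom of choice built in, a theorem of ZF cannot be rendered by a statement
  about HOL sets or HOL topological spaces without losing its content. Instead, it is stated as a
  truth in every model \<open>(V, mem)\<close> of first-order ZF, where \<open>V\<close> is the universe of
  an arbitrary type \<^typ>\<open>'a\<close> and \<open>mem\<close> an arbitrary binary relation on it.

  All notions below are internal to the model: sets, functions, topologies, covers, ideals,
  finite sets and \<open>\<omega>\<close> are \<^emph>\<open>elements\<close> of \<open>V\<close>, and every quantifier ranges over elements
  of \<open>V\<close>, never over external sets or functions. HOL set notation such as
  \<open>elts u \<subseteq> elts X\<close> only abbreviates first-order conditions on \<open>mem\<close>.
\<close>

text \<open>Formulas of the language of set theory, with variables named by natural numbers.\<close>

datatype fm =
    Mem nat nat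
  | Equ nat nat
  | Neg fm
  | Conj fm fm
  | Ex nat fm

locale membership =
  fixes mem :: "'a \<Rightarrow> 'a \<Rightarrow> bool"
begin

primrec sat :: "fm \<Rightarrow> (nat \<Rightarrow> 'a) \<Rightarrow> bool" where
  "sat (Mem i j) \<rho> \<longleftrightarrow> mem (\<rho> i) (\<rho> j)"
| "sat (Equ i j) \<rho> \<longleftrightarrow> \<rho> i = \<rho> j"
| "sat (Neg \<phi>) \<rho> \<longleftrightarrow> \<not> sat \<phi> \<rho>"
| "sat (Conj \<phi> \<psi>) \<rho> \<longleftrightarrow> sat \<phi> \<rho> \<and> sat \<psi> \<rho>"
| "sat (Ex i \<phi>) \<rho> \<longleftrightarrow> (\<exists>x. sat \<phi> (\<rho>(i := x)))"

definition elts :: "'a \<Rightarrow> 'a set" where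
  "elts x = {z. mem z x}"

definition is_Union :: "'a \<Rightarrow> 'a \<Rightarrow> bool" where
  "is_Union u S \<longleftrightarrow> elts u = (\<Union>v\<in>elts S. elts v)"

definition is_succ :: "'a \<Rightarrow> 'a \<Rightarrow> bool" where
  "is_succ s x \<longleftrightarrow> elts s = insert x (elts x)"

definition is_inductive :: "'a \<Rightarrow> bool" where
  "is_inductive w \<longleftrightarrow>
     (\<exists>z\<in>elts w. elts z = {}) \<and> (\<forall>x\<in>elts w. \<exists>s\<in>elts w. is_succ s x)"

end

text \<open>
  Separation and Replacement are the first-order schemes: one instance for every formula
  \<open>\<phi>\<close>, with parameters supplied by the assignment \<open>\<rho>\<close>. (The second-order versions,
  quantifying over HOL predicates, would import choice from the metatheory into the model.)
\<close>

locale ZF_model = membership mem for mem :: "'a \<Rightarrow> 'a \<Rightarrow> bool" +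
  assumes extensionality: "\<And>x y. elts x = elts y \<Longrightarrow> x = y"
    and foundation: "\<And>x. elts x \<noteq> {} \<Longrightarrow> \<exists>y\<in>elts x. elts y \<inter> elts x = {}"
    and pairing: "\<And>a b. \<exists>p. elts p = {a, b}"
    and union: "\<And>S. \<exists>u. is_Union u S"
    and powerset: "\<And>x. \<exists>p. elts p = {y. elts y \<subseteq> elts x}"
    and infinity: "\<exists>w. is_inductive w"
    and separation: "\<And>\<phi> \<rho> x. \<exists>y. elts y = {z \<in> elts x. sat \<phi> (\<rho>(0 := z))}"
    and replacement:
      "\<And>\<phi> \<rho> x.
         (\<And>z y y'. z \<in> elts x \<Longrightarrow> sat \<phi> (\<rho>(0 := z, 1 := y)) \<Longrightarrow>
            sat \<phi> (\<rho>(0 := z, 1 := y')) \<Longrightarrow> y = y') \<Longrightarrow>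
         \<exists>r. elts r = {y. \<exists>z\<in>elts x. sat \<phi> (\<rho>(0 := z, 1 := y))}"

context membership
begin

subsection \<open>Functions and finiteness\<close>

text \<open>Kuratowski pairs; functions are sets of pairs.\<close>

definition is_pair :: "'a \<Rightarrow> 'a \<Rightarrow> 'a \<Rightarrow> bool" where
  "is_pair p a b \<longleftrightarrow> (\<exists>s d. elts s = {a} \<and> elts d = {a, b} \<and> elts p = {s, d})"

definition graph_of :: "'a \<Rightarrow> ('a \<times> 'a) set" where
  "graph_of f = {(x, y). \<exists>p\<in>elts f. is_pair p x y}"

definition maps :: "'a \<Rightarrow> 'a \<Rightarrow> 'a \<Rightarrow> bool" where
  "maps f X Y \<longleftrightarrow>
     (\<forall>p\<in>elts f. \<exists>x\<in>elts X. \<exists>y\<in>elts Y. is_pair p x y) \<and>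
     (\<forall>x\<in>elts X. \<exists>!y. (x, y) \<in> graph_of f)"

definition injective :: "'a \<Rightarrow> bool" where
  "injective f \<longleftrightarrow> (\<forall>x x' y. (x, y) \<in> graph_of f \<and> (x', y) \<in> graph_of f \<longrightarrow> x = x')"

definition equipotent :: "'a \<Rightarrow> 'a \<Rightarrow> bool" where
  "equipotent X Y \<longleftrightarrow> (\<exists>f. maps f X Y \<and> injective f \<and> graph_of f `` elts X = elts Y)"

definition is_omega :: "'a \<Rightarrow> bool" where
  "is_omega w \<longleftrightarrow> is_inductive w \<and> (\<forall>v. is_inductive v \<longrightarrow> elts w \<subseteq> elts v)"

definition finite_set :: "'a \<Rightarrow> bool" where
  "finite_set X \<longleftrightarrow> (\<exists>w. is_omega w \<and> (\<exists>n\<in>elts w. equipotent X n))"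

subsection \<open>The Boolean prime ideal theorem\<close>

text \<open>In a model of ZF, the descriptions below denote whenever \<open>f\<close> is a function defined at
  \<open>x\<close>, respectively at the pair of \<open>x\<close> and \<open>y\<close>.\<close>

definition val :: "'a \<Rightarrow> 'a \<Rightarrow> 'a" where
  "val f x = (THE y. (x, y) \<in> graph_of f)"

definition val2 :: "'a \<Rightarrow> 'a \<Rightarrow> 'a \<Rightarrow> 'a" where
  "val2 f x y = val f (THE p. is_pair p x y)"

definition binary_operation :: "'a \<Rightarrow> 'a \<Rightarrow> bool" where
  "binary_operation f B \<longleftrightarrow>
     (\<exists>P. elts P = {p. \<exists>x\<in>elts B. \<exists>y\<in>elts B. is_pair p x y} \<and> maps f P B)"

text \<open>Boolean algebras are required to be nondegenerate; a one-element algebra has no proper,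
  hence no prime, ideal.\<close>

definition boolean_algebra :: "'a \<Rightarrow> 'a \<Rightarrow> 'a \<Rightarrow> 'a \<Rightarrow> 'a \<Rightarrow> 'a \<Rightarrow> bool" where
  "boolean_algebra B join meet compl bt tp \<longleftrightarrow>
     binary_operation join B \<and> binary_operation meet B \<and> maps compl B B \<and>
     bt \<in> elts B \<and> tp \<in> elts B \<and> bt \<noteq> tp \<and>
     (\<forall>x\<in>elts B. \<forall>y\<in>elts B.
        val2 join x y = val2 join y x \<and>
        val2 meet x y = val2 meet y x \<and>
        val2 join x (val2 meet x y) = x \<and>
        val2 meet x (val2 join x y) = x) \<and>
     (\<forall>x\<in>elts B. \<forall>y\<in>elts B. \<forall>z\<in>elts B.
        val2 join x (val2 join y z) = val2 join (val2 join x y) z \<and>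
        val2 meet x (val2 meet y z) = val2 meet (val2 meet x y) z \<and>
        val2 meet x (val2 join y z) = val2 join (val2 meet x y) (val2 meet x z) \<and>
        val2 join x (val2 meet y z) = val2 meet (val2 join x y) (val2 join x z)) \<and>
     (\<forall>x\<in>elts B.
        val2 join x (val compl x) = tp \<and> val2 meet x (val compl x) = bt)"

definition prime_ideal :: "'a \<Rightarrow> 'a \<Rightarrow> 'a \<Rightarrow> 'a \<Rightarrow> 'a \<Rightarrow> 'a \<Rightarrow> bool" where
  "prime_ideal I B join meet bt tp \<longleftrightarrow>
     elts I \<subseteq> elts B \<and> bt \<in> elts I \<and> tp \<notin> elts I \<and>
     (\<forall>x\<in>elts I. \<forall>y\<in>elts I. val2 join x y \<in> elts I) \<and>
     (\<forall>x\<in>elts I. \<forall>y\<in>elts B. val2 meet x y = y \<longrightarrow> y \<in> elts I) \<and>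
     (\<forall>x\<in>elts B. \<forall>y\<in>elts B. val2 meet x y \<in> elts I \<longrightarrow> x \<in> elts I \<or> y \<in> elts I)"

definition BPI :: bool where
  "BPI \<longleftrightarrow>
     (\<forall>B join meet compl bt tp. boolean_algebra B join meet compl bt tp \<longrightarrow>
        (\<exists>I. prime_ideal I B join meet bt tp))"

subsection \<open>Topological spaces\<close>

definition topology_on :: "'a \<Rightarrow> 'a \<Rightarrow> bool" where
  "topology_on X T \<longleftrightarrow>
     (\<forall>u\<in>elts T. elts u \<subseteq> elts X) \<and>
     (\<exists>u\<in>elts T. elts u = {}) \<and> X \<in> elts T \<and>
     (\<forall>S. elts S \<subseteq> elts T \<longrightarrow> (\<exists>u\<in>elts T. is_Union u S)) \<and>
     (\<forall>u\<in>elts T. \<forall>v\<in>elts T. \<exists>w\<in>elts T. elts w = elts u \<inter> elts v)"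

definition closed_in :: "'a \<Rightarrow> 'a \<Rightarrow> 'a \<Rightarrow> bool" where
  "closed_in X T c \<longleftrightarrow> elts c \<subseteq> elts X \<and> (\<exists>u\<in>elts T. elts u = elts X - elts c)"

definition clopen_in :: "'a \<Rightarrow> 'a \<Rightarrow> 'a \<Rightarrow> bool" where
  "clopen_in X T c \<longleftrightarrow> c \<in> elts T \<and> closed_in X T c"

definition zero_dimensional :: "'a \<Rightarrow> 'a \<Rightarrow> bool" where
  "zero_dimensional X T \<longleftrightarrow>
     (\<forall>u\<in>elts T. \<exists>S. (\<forall>c\<in>elts S. clopen_in X T c) \<and> is_Union u S)"

definition T1_space :: "'a \<Rightarrow> 'a \<Rightarrow> bool" where
  "T1_space X T \<longleftrightarrow>
     (\<forall>x\<in>elts X. \<forall>y\<in>elts X. x \<noteq> y \<longrightarrow> (\<exists>u\<in>elts T. x \<in> elts u \<and> y \<notin> elts u))"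

definition compact_space :: "'a \<Rightarrow> 'a \<Rightarrow> bool" where
  "compact_space X T \<longleftrightarrow>
     (\<forall>S. elts S \<subseteq> elts T \<and> is_Union X S \<longrightarrow>
        (\<exists>F. elts F \<subseteq> elts S \<and> finite_set F \<and> is_Union X F))"

definition continuous :: "'a \<Rightarrow> 'a \<Rightarrow> 'a \<Rightarrow> 'a \<Rightarrow> 'a \<Rightarrow> bool" where
  "continuous X T Y S f \<longleftrightarrow>
     maps f X Y \<and> (\<forall>v\<in>elts S. \<exists>u\<in>elts T. elts u = (graph_of f)\<inverse> `` elts v)"

text \<open>A homeomorphism onto the image, the latter with the subspace topology.\<close>

definition embedding :: "'a \<Rightarrow> 'a \<Rightarrow> 'a \<Rightarrow> 'a \<Rightarrow> 'a \<Rightarrow> bool" where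
  "embedding X T Y S f \<longleftrightarrow>
     continuous X T Y S f \<and> injective f \<and>
     (\<forall>u\<in>elts T. \<exists>v\<in>elts S. graph_of f `` elts u = elts v \<inter> graph_of f `` elts X)"

definition compactification :: "'a \<Rightarrow> 'a \<Rightarrow> 'a \<Rightarrow> 'a \<Rightarrow> 'a \<Rightarrow> bool" where
  "compactification X T Y S a \<longleftrightarrow>
     topology_on Y S \<and> compact_space Y S \<and> embedding X T Y S a \<and>
     (\<forall>v\<in>elts S. elts v \<noteq> {} \<longrightarrow> elts v \<inter> graph_of a `` elts X \<noteq> {})"

definition banaschewski_compactification :: "'a \<Rightarrow> 'a \<Rightarrow> 'a \<Rightarrow> 'a \<Rightarrow> 'a \<Rightarrow> bool" where
  "banaschewski_compactification X T Y S b \<longleftrightarrow>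
     compactification X T Y S b \<and> zero_dimensional Y S \<and> T1_space Y S \<and>
     (\<forall>K R f. topology_on K R \<and> compact_space K R \<and> zero_dimensional K R \<and> T1_space K R \<and>
        continuous X T K R f \<longrightarrow>
        (\<exists>g. continuous Y S K R g \<and> graph_of b O graph_of g = graph_of f))"

definition has_banaschewski :: "'a \<Rightarrow> 'a \<Rightarrow> bool" where
  "has_banaschewski X T \<longleftrightarrow> (\<exists>Y S b. banaschewski_compactification X T Y S b)"

subsection \<open>Discrete spaces and Cantor cubes\<close>

definition discrete_topology :: "'a \<Rightarrow> 'a \<Rightarrow> bool" where
  "discrete_topology X T \<longleftrightarrow> elts T = {u. elts u \<subseteq> elts X}"

text \<open>\<open>Y\<close> to the power \<open>J\<close>, with the coarsest topology making all projections continuous.\<close>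

definition projections_continuous :: "'a \<Rightarrow> 'a \<Rightarrow> 'a \<Rightarrow> 'a \<Rightarrow> bool" where
  "projections_continuous J S C T \<longleftrightarrow>
     (\<forall>j\<in>elts J. \<forall>v\<in>elts S. \<exists>u\<in>elts T. elts u = {f \<in> elts C. \<exists>y\<in>elts v. (j, y) \<in> graph_of f})"

definition power_space :: "'a \<Rightarrow> 'a \<Rightarrow> 'a \<Rightarrow> 'a \<Rightarrow> 'a \<Rightarrow> bool" where
  "power_space J Y S C T \<longleftrightarrow>
     elts C = {f. maps f J Y} \<and>
     topology_on C T \<and> projections_continuous J S C T \<and>
     (\<forall>T'. topology_on C T' \<and> projections_continuous J S C T' \<longrightarrow> elts T \<subseteq> elts T')"

definition is_two :: "'a \<Rightarrow> bool" where
  "is_two t \<longleftrightarrow> (\<exists>z s. elts z = {} \<and> elts s = {z} \<and> elts t = {z, s})"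

definition cantor_cube :: "'a \<Rightarrow> 'a \<Rightarrow> 'a \<Rightarrow> bool" where
  "cantor_cube J C T \<longleftrightarrow>
     (\<exists>t D. is_two t \<and> discrete_topology t D \<and> power_space J t D C T)"

end

end

theory Submission
  imports Defs
begin

text \<open>
  Throughout, \<open>(V, mem)\<close> is a model of first-order ZF. The choice principle of HOL may be used to
  reason about the model but not to build its elements: a collection of elements of \<open>V\<close> is known
  to be a set of the model only if it is carved out of a set by a formula with parameters, or is
  the image of a set under an operation given by such a formula. For this reason the first part
  sets up a calculus of definable predicates, terms and collections. With it, separation,
  replacement and induction over finite sets become available for properties written in ordinary
  HOL notation. Finite always means finite in the sense of the model, so induction over finite sets
  is available for definable properties only.

  BPI implies that Banaschewski compactifications exist. For a zero-dimensional \<open>T\<^sub>1\<close>-space \<open>X\<close>, the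
  compactification is the Stone space of the algebra of clopen subsets of \<open>X\<close>, and \<open>x\<close> is sent to
  the ultrafilter of the clopen sets that contain it. A map \<open>f\<close> into a compact zero-dimensional
  \<open>T\<^sub>1\<close>-space \<open>K\<close> extends to an ultrafilter \<open>p\<close> as the only point \<open>y\<close> such that the preimages of all
  clopen neighbourhoods of \<open>y\<close> belong to \<open>p\<close>; as the point is unique, the extension is definable. BPI
  is used for the compactness of the Stone space only: if a cover had no finite subcover, the
  clopen sets whose basic open sets are covered by finitely many members would form a proper ideal, and
  a prime ideal in the quotient algebra yields an ultrafilter that avoids this ideal, hence a
  point that the cover misses (\<open>ultrafilter_avoiding_ideal\<close>, \<open>compact_stone\<close>,
  \<open>banaschewski_stone\<close>). Discrete spaces and Cantor cubes are zero-dimensional \<open>T\<^sub>1\<close>-spaces, so this case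
  settles the other two.

  Conversely, let \<open>B\<close> be a Boolean algebra and \<open>Y\<close> the compactification of a discrete space whose points
  include those of \<open>B\<close>, or of the Cantor cube over an index set that includes \<open>B\<close>. Send \<open>m \<in> B\<close> to
  the point of \<open>Y\<close> given by \<open>m\<close> itself, respectively by the characteristic function of
  \<open>{a. m \<le> a}\<close>. For each \<open>a\<close>, the clopen set \<open>{m. m \<le> a}\<close>, respectively the clopen set of the
  functions with value \<open>1\<close> at \<open>a\<close>, has a characteristic function, which extends to \<open>Y\<close>. This gives a clopen
  \<open>G\<^sub>a \<subseteq> Y\<close> that contains the point of \<open>m\<close> if and only if \<open>m \<le> a\<close> (\<open>banaschewski_clopen\<close>).

  It remains to find a prime ideal from the compactness of \<open>Y\<close> and from the sets \<open>G\<^sub>a\<close>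
  (\<open>prime_ideal_from_compact_space\<close>). The argument is one of forcing, with the nonzero elements of
  \<open>B\<close> as conditions: call an open set small if every condition has a stronger condition \<open>m'\<close>
  such that no condition below \<open>m'\<close> has its point in the set. Small sets are closed under finite
  unions and the whole of \<open>Y\<close> is not small, so by compactness some \<open>y \<in> Y\<close> lies in no small open set.
  Such a \<open>y\<close> behaves like a generic point, and the \<open>a\<close> with \<open>y \<notin> G\<^sub>a\<close> form a prime ideal. For example, if
  \<open>y\<close> were in \<open>G\<^bsub>a \<squnion> b\<^esub>\<close> but in neither \<open>G\<^sub>a\<close> nor \<open>G\<^sub>b\<close>, it would lie in the small
  set \<open>G\<^bsub>a \<squnion> b\<^esub> - G\<^sub>a - G\<^sub>b\<close>: each condition meets \<open>a\<close>, or meets \<open>b\<close>, or is disjoint from \<open>a \<squnion> b\<close>.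
\<close>

section \<open>Definability with parameters\<close>

context membership
begin

text \<open>
  A formula has one supply of variables. The even ones are read from the environment \<open>e\<close>, the odd
  ones from the parameters \<open>c\<close>, so that there is always room for further parameters.
\<close>

definition interleave :: "(nat \<Rightarrow> 'a) \<Rightarrow> (nat \<Rightarrow> 'a) \<Rightarrow> nat \<Rightarrow> 'a" where
  "interleave e c i = (if even i then e (i div 2) else c (i div 2))"

definition definable :: "((nat \<Rightarrow> 'a) \<Rightarrow> bool) \<Rightarrow> bool" where
  "definable P \<longleftrightarrow> (\<exists>\<phi> c. \<forall>e. P e \<longleftrightarrow> sat \<phi> (interleave e c))"

text \<open>
  In the two definitions below, variable \<open>0\<close> stands for the value of the term, or for a candidate
  member of the collection, and the variables of the context are shifted by one. The same
  de Bruijn convention governs all rules for binders.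
\<close>

definition definable_term :: "((nat \<Rightarrow> 'a) \<Rightarrow> 'a) \<Rightarrow> bool" where
  "definable_term s \<longleftrightarrow> definable (\<lambda>e. e 0 = s (\<lambda>i. e (Suc i)))"

definition definable_set :: "((nat \<Rightarrow> 'a) \<Rightarrow> 'a set) \<Rightarrow> bool" where
  "definable_set A \<longleftrightarrow> definable (\<lambda>e. e 0 \<in> A (\<lambda>i. e (Suc i)))"

end

primrec rename :: "(nat \<Rightarrow> nat) \<Rightarrow> fm \<Rightarrow> fm" where
  "rename r (Mem i j) = Mem (r i) (r j)"
| "rename r (Equ i j) = Equ (r i) (r j)"
| "rename r (Neg \<phi>) = Neg (rename r \<phi>)"
| "rename r (Conj \<phi> \<psi>) = Conj (rename r \<phi>) (rename r \<psi>)"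
| "rename r (Ex i \<phi>) = Ex (r i) (rename r \<phi>)"

context membership
begin

lemma sat_rename:
  assumes "inj r"
  shows "sat (rename r \<phi>) \<rho> \<longleftrightarrow> sat \<phi> (\<rho> \<circ> r)"
proof (induction \<phi> arbitrary: \<rho>)
  case (Ex i \<phi>)
  have "(\<rho>(r i := x)) \<circ> r = (\<rho> \<circ> r)(i := x)" for x
    using assms by (auto simp: fun_eq_iff inj_eq)
  then show ?case by (simp only: rename.simps sat.simps Ex.IH)
qed auto

text \<open>
  Injectivity keeps bound variables from being captured; all the renamings below, which are shifts,
  permutations, and embeddings into the even or odd variables, are injective.
\<close>

lemma definable_rename:
  assumes "definable P" "inj r"
  shows "definable (\<lambda>e. P (\<lambda>i. e (r i)))"
proof -
  obtain \<phi> c where *: "\<And>e. P e \<longleftrightarrow> sat \<phi> (interleave e c)"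
    using assms(1) by (auto simp: definable_def)
  define q where "q i = (if even i then 2 * r (i div 2) else i)" for i
  have "inj q"
    unfolding inj_def q_def
  proof (intro allI impI)
    fix x y assume "(if even x then 2 * r (x div 2) else x) = (if even y then 2 * r (y div 2) else y)"
    then show "x = y"
      using injD[OF assms(2), of "x div 2" "y div 2"]
      by (auto split: if_splits elim!: evenE)
  qed
  have "interleave e c \<circ> q = interleave (\<lambda>i. e (r i)) c" for e
    by (auto simp: fun_eq_iff interleave_def q_def)
  then have "P (\<lambda>i. e (r i)) \<longleftrightarrow> sat (rename q \<phi>) (interleave e c)" for e
    by (simp add: * sat_rename[OF \<open>inj q\<close>])
  then show ?thesis unfolding definable_def by blast
qed

lemma definable_not: "definable P \<Longrightarrow> definable (\<lambda>e. \<not> P e)"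
  unfolding definable_def by (metis sat.simps(3))

text \<open>
  The two formulas come with different parameters, which have to be interleaved.
\<close>

lemma definable_conj:
  assumes "definable P" "definable Q"
  shows "definable (\<lambda>e. P e \<and> Q e)"
proof -
  obtain \<phi> c \<psi> d where *: "\<And>e. P e \<longleftrightarrow> sat \<phi> (interleave e c)"
    "\<And>e. Q e \<longleftrightarrow> sat \<psi> (interleave e d)"
    using assms by (auto simp: definable_def)
  \<comment> \<open>Parameter \<open>n\<close> of formula \<open>k\<close> becomes parameter \<open>2 * n + k\<close>, hence variable \<open>2 * (2 * n + k) + 1\<close>.\<close>
  define q where "q k i = (if even i then i else 4 * (i div 2) + 2 * k + 1)" for i k :: nat
  have inj: "inj (q 0)" "inj (q (Suc 0))"
    by (auto simp: inj_def q_def split: if_splits elim!: oddE)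
  have "interleave e (interleave c d) \<circ> q 0 = interleave e c"
    "interleave e (interleave c d) \<circ> q (Suc 0) = interleave e d" for e
    by (auto simp: fun_eq_iff interleave_def q_def elim!: oddE)
  then have "P e \<and> Q e \<longleftrightarrow>
      sat (Conj (rename (q 0) \<phi>) (rename (q (Suc 0)) \<psi>)) (interleave e (interleave c d))" for e
    by (simp add: * sat_rename inj)
  then show ?thesis unfolding definable_def by blast
qed

text \<open>
  The quantified variable of the context is moved among the parameters, to variable \<open>1\<close>, where it can be bound
  by \<^const>\<open>Ex\<close>.
\<close>

lemma definable_ex:
  assumes "definable (\<lambda>e. Q (e 0) (\<lambda>i. e (Suc i)))"
  shows "definable (\<lambda>e. \<exists>x. Q x e)"
proof -
  obtain \<phi> c where *: "\<And>e. Q (e 0) (\<lambda>i. e (Suc i)) \<longleftrightarrow> sat \<phi> (interleave e c)"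
    using assms by (auto simp: definable_def)
  \<comment> \<open>Context variables move down by one, parameters up by one, and variable \<open>1\<close> becomes free.\<close>
  define q :: "nat \<Rightarrow> nat" where "q i = (if i = 0 then 1 else if even i then i - 2 else i + 2)" for i
  have inj: "inj q"
    unfolding inj_def q_def by (auto split: if_splits elim!: oddE evenE) presburger+
  have "(interleave e (case_nat undefined c))(1 := x) \<circ> q = interleave (case_nat x e) c" for e x
    unfolding interleave_def q_def
    by (auto simp: fun_eq_iff split: nat.split elim!: evenE oddE)
  then have "(\<exists>x. Q x e) \<longleftrightarrow>
      sat (Ex 1 (rename q \<phi>)) (interleave e (case_nat undefined c))" for e
    using *[of "case_nat _ e"] by (simp add: sat_rename inj)
  then show ?thesis unfolding definable_def by blast
qed

lemma definable_var:
  "definable (\<lambda>e. mem (e i) (e j))" "definable (\<lambda>e. e i = e j)" "definable (\<lambda>e. e i = c)"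
proof -
  show "definable (\<lambda>e. mem (e i) (e j))"
    unfolding definable_def by (rule exI[of _ "Mem (2*i) (2*j)"]) (auto simp: interleave_def)
  show "definable (\<lambda>e. e i = e j)"
    unfolding definable_def by (rule exI[of _ "Equ (2*i) (2*j)"]) (auto simp: interleave_def)
  show "definable (\<lambda>e. e i = c)"
    unfolding definable_def
    by (rule exI[of _ "Equ (2*i) 1"], rule exI[of _ "\<lambda>_. c"]) (auto simp: interleave_def)
qed

named_theorems dfn

lemma definable_shift: "definable_term s \<Longrightarrow> definable_term (\<lambda>e. s (\<lambda>i. e (Suc i)))"
  using definable_rename[of "\<lambda>e. e 0 = s (\<lambda>i. e (Suc i))" "\<lambda>i. if i = 0 then 0 else Suc i"]
  unfolding definable_term_def by (auto simp: inj_def)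

text \<open>
  Substitution of a definable term goes through the formula \<open>\<exists>x. x = s \<and> Q x\<close>. The versions for one,
  two and three arguments that follow let the definability of a notion be checked for variables only.
\<close>

lemma definable_subst:
  assumes "definable (\<lambda>e. Q (e 0) (\<lambda>i. e (Suc i)))" "definable_term s"
  shows "definable (\<lambda>e. Q (s e) e)"
proof -
  have "definable (\<lambda>e. \<exists>x. x = s e \<and> Q x e)"
    using assms by (intro definable_ex definable_conj) (auto simp: definable_term_def)
  then show ?thesis by simp
qed

lemma definable_rename_eq:
  assumes "definable P" "P' = (\<lambda>e. P (\<lambda>i. e (r i)))" "inj r" shows "definable P'"
  using definable_rename[OF assms(1,3)] assms(2) by simp

lemma definable1:
  "definable (\<lambda>e. P (e 0)) \<Longrightarrow> definable_term s \<Longrightarrow> definable (\<lambda>e. P (s e))"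
  using definable_subst[of "\<lambda>x e. P x"] by simp

lemma definable2:
  assumes "definable (\<lambda>e. P (e 0) (e (Suc 0)))" "definable_term s" "definable_term t"
  shows "definable (\<lambda>e. P (s e) (t e))"
proof -
  have "definable (\<lambda>e. P (e 0) (t (\<lambda>i. e (Suc i))))"
  proof (rule definable_subst[of "\<lambda>y e. P (e 0) y" "\<lambda>e. t (\<lambda>i. e (Suc i))", simplified])
    show "definable (\<lambda>e. P (e (Suc 0)) (e 0))"
      by (rule definable_rename_eq[OF assms(1), of _ "\<lambda>i. if i = 0 then 1 else if i = 1 then 0 else i"])
        (auto simp: inj_def)
  qed (rule definable_shift[OF assms(3)])
  from definable_subst[of "\<lambda>x e. P x (t e)", OF this assms(2)] show ?thesis .
qed

lemma definable3:
  assumes "definable (\<lambda>e. P (e 0) (e (Suc 0)) (e (Suc (Suc 0))))"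
    "definable_term s" "definable_term t" "definable_term r"
  shows "definable (\<lambda>e. P (s e) (t e) (r e))"
proof -
  have "definable (\<lambda>e. P (e 0) (e (Suc 0)) (r (\<lambda>i. e (Suc (Suc i)))))"
  proof (rule definable_subst[of "\<lambda>y e. P (e 0) (e (Suc 0)) y" "\<lambda>e. r (\<lambda>i. e (Suc (Suc i)))", simplified])
    show "definable (\<lambda>e. P (e (Suc 0)) (e (Suc (Suc 0))) (e 0))"
      by (rule definable_rename_eq[OF assms(1), of _ "\<lambda>i. if i = 0 then 1 else if i = 1 then 2 else if i = 2 then 0 else i"])
        (auto simp: inj_def numeral_2_eq_2)
  qed (use definable_shift[OF definable_shift[OF assms(4)]] in simp)
  then have "definable (\<lambda>e. P (e 0) (t (\<lambda>i. e (Suc i))) (r (\<lambda>i. e (Suc i))))"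
  proof -
    assume a: "definable (\<lambda>e. P (e 0) (e (Suc 0)) (r (\<lambda>i. e (Suc (Suc i)))))"
    show ?thesis
    proof (rule definable_subst[of "\<lambda>y e. P (e 0) y (r (\<lambda>i. e (Suc i)))" "\<lambda>e. t (\<lambda>i. e (Suc i))", simplified])
      show "definable (\<lambda>e. P (e (Suc 0)) (e 0) (r (\<lambda>i. e (Suc (Suc i)))))"
        by (rule definable_rename_eq[OF a, of _ "\<lambda>i. if i = 0 then 1 else if i = 1 then 0 else i"])
          (auto simp: inj_def)
    qed (rule definable_shift[OF assms(3)])
  qed
  from definable_subst[of "\<lambda>x e. P x (t e) (r e)", OF this assms(2)] show ?thesis .
qed

lemma definable_term_var [dfn]: "definable_term (\<lambda>e. e i)"
  unfolding definable_term_def by (rule definable_var)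

lemma definable_term_const [dfn]: "definable_term (\<lambda>e. c)"
  unfolding definable_term_def by (rule definable_var)

lemma definable_term1:
  "definable_term (\<lambda>e. F (e 0)) \<Longrightarrow> definable_term s \<Longrightarrow> definable_term (\<lambda>e. F (s e))"
  unfolding definable_term_def[of "\<lambda>e. F (e 0)"] definable_term_def[of "\<lambda>e. F (s e)"]
  by (rule definable2[of "\<lambda>x y. x = F y" "\<lambda>e. e 0" "\<lambda>e. s (\<lambda>i. e (Suc i))"])
    (auto intro: definable_shift definable_term_var)

lemma definable_term2:
  "definable_term (\<lambda>e. F (e 0) (e (Suc 0))) \<Longrightarrow> definable_term s \<Longrightarrow> definable_term t \<Longrightarrow>
    definable_term (\<lambda>e. F (s e) (t e))"
  unfolding definable_term_def[of "\<lambda>e. F (e 0) (e (Suc 0))"] definable_term_def[of "\<lambda>e. F (s e) (t e)"]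
  by (rule definable3[of "\<lambda>x y z. x = F y z" "\<lambda>e. e 0"
        "\<lambda>e. s (\<lambda>i. e (Suc i))" "\<lambda>e. t (\<lambda>i. e (Suc i))"])
    (auto intro: definable_shift definable_term_var)

lemmas definable_mem [dfn] = definable2[of mem, OF definable_var(1)]
lemmas definable_eq [dfn] = definable2[of "(=)", OF definable_var(2)]

lemma definable_connectives [dfn]:
  "definable P \<Longrightarrow> definable (\<lambda>e. \<not> P e)"
  "definable P \<Longrightarrow> definable Q \<Longrightarrow> definable (\<lambda>e. P e \<and> Q e)"
  "definable P \<Longrightarrow> definable Q \<Longrightarrow> definable (\<lambda>e. P e \<or> Q e)"
  "definable P \<Longrightarrow> definable Q \<Longrightarrow> definable (\<lambda>e. P e \<longrightarrow> Q e)"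
  "definable P \<Longrightarrow> definable Q \<Longrightarrow> definable (\<lambda>e. P e = Q e)"
proof -
  assume P: "definable P"
  then show "definable (\<lambda>e. \<not> P e)" by (rule definable_not)
  assume Q: "definable Q"
  show "definable (\<lambda>e. P e \<and> Q e)" using P Q by (rule definable_conj)
  have imp: "definable (\<lambda>e. P e \<longrightarrow> Q e)" if "definable P" "definable Q" for P Q
    using definable_not[OF definable_conj[OF that(1) definable_not[OF that(2)]]] by simp
  show "definable (\<lambda>e. P e \<longrightarrow> Q e)" using P Q by (rule imp)
  show "definable (\<lambda>e. P e \<or> Q e)"
    using imp[OF definable_not[OF P] Q] by (simp add: disj_imp)
  show "definable (\<lambda>e. P e = Q e)"
    using definable_conj[OF imp[OF P Q] imp[OF Q P]] by (simp add: iff_conv_conj_imp)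
qed

lemma definable_const [dfn]: "definable (\<lambda>e. C)"
  using definable_var(2)[of 0 0] definable_not[OF definable_var(2)[of 0 0]] by (cases C) auto

lemma definable_all [dfn]:
  "definable (\<lambda>e. Q (e 0) (\<lambda>i. e (Suc i))) \<Longrightarrow> definable (\<lambda>e. \<forall>x. Q x e)"
  using definable_not[OF definable_ex[OF definable_not], of Q] by simp

lemmas [dfn] = definable_ex

lemma definable_in [dfn]:
  "definable_term s \<Longrightarrow> definable_set A \<Longrightarrow> definable (\<lambda>e. s e \<in> A e)"
  unfolding definable_set_def by (rule definable_subst[of "\<lambda>x e. x \<in> A e"])

lemma definable_quantifiers [dfn]:
  "definable_set A \<Longrightarrow> definable (\<lambda>e. Q (e 0) (\<lambda>i. e (Suc i))) \<Longrightarrow> definable (\<lambda>e. \<forall>x\<in>A e. Q x e)"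
  "definable_set A \<Longrightarrow> definable (\<lambda>e. Q (e 0) (\<lambda>i. e (Suc i))) \<Longrightarrow> definable (\<lambda>e. \<exists>x\<in>A e. Q x e)"
  "definable_set A \<Longrightarrow> definable_set B \<Longrightarrow> definable (\<lambda>e. A e \<subseteq> B e)"
  "definable_set A \<Longrightarrow> definable_set B \<Longrightarrow> definable (\<lambda>e. A e = B e)"
  unfolding definable_set_def Ball_def Bex_def subset_iff set_eq_iff
  by (auto intro!: dfn)

lemma definable_set_elts [dfn]: "definable_term s \<Longrightarrow> definable_set (\<lambda>e. elts (s e))"
  unfolding definable_set_def elts_def mem_Collect_eq
  by (intro dfn definable_shift)

lemma definable_set_intros [dfn]:
  "definable (\<lambda>e. Q (e 0) (\<lambda>i. e (Suc i))) \<Longrightarrow> definable_set (\<lambda>e. {z. Q z e})"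
  "definable_set (\<lambda>e. {})"
  "definable_set A \<Longrightarrow> definable_set B \<Longrightarrow> definable_set (\<lambda>e. A e \<union> B e)"
  "definable_set A \<Longrightarrow> definable_set B \<Longrightarrow> definable_set (\<lambda>e. A e \<inter> B e)"
  "definable_set A \<Longrightarrow> definable_set B \<Longrightarrow> definable_set (\<lambda>e. A e - B e)"
  unfolding definable_set_def
  by (auto simp: intro: dfn)

lemma definable_set_insert [dfn]:
  "definable_term s \<Longrightarrow> definable_set A \<Longrightarrow> definable_set (\<lambda>e. insert (s e) (A e))"
  unfolding definable_set_def insert_iff
  by (rule definable_connectives) (auto simp: definable_term_def)

lemma definable_if [dfn]:
  assumes "definable P" "definable_term s" "definable_term t"
  shows "definable_term (\<lambda>e. if P e then s e else t e)"
proof -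
  have [dfn]: "definable (\<lambda>e. P (\<lambda>i. e (Suc i)))"
    by (rule definable_rename[OF assms(1)]) simp
  have "definable (\<lambda>e. (P (\<lambda>i. e (Suc i)) \<and> e 0 = s (\<lambda>i. e (Suc i))) \<or>
      (\<not> P (\<lambda>i. e (Suc i)) \<and> e 0 = t (\<lambda>i. e (Suc i))))"
    by (intro dfn definable_shift assms)
  then show ?thesis
    unfolding definable_term_def by (rule back_subst[of definable]) auto
qed

lemma definable_set_shift: "definable_set A \<Longrightarrow> definable_set (\<lambda>e. A (\<lambda>i. e (Suc i)))"
  using definable_rename[of "\<lambda>e. e 0 \<in> A (\<lambda>i. e (Suc i))" "\<lambda>i. if i = 0 then 0 else Suc i"]
  unfolding definable_set_def by (auto simp: inj_def)

text \<open>
  When no value exists, the description is the same unspecified element for all environments, which is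
  a parameter. Uniqueness matters, since otherwise the value of the description would depend on the predicate.
\<close>

lemma definable_term_The:
  assumes R: "definable (\<lambda>e. R (e 0) (\<lambda>i. e (Suc i)))"
    and unique: "\<And>e x y. R x e \<Longrightarrow> R y e \<Longrightarrow> x = y"
  shows "definable_term (\<lambda>e. THE x. R x e)"
proof -
  have *: "(y = (THE x. R x e)) \<longleftrightarrow> R y e \<or> (\<not> (\<exists>x. R x e) \<and> y = (THE x. False))" for y e
  proof (cases "\<exists>x. R x e")
    case True
    then show ?thesis using unique by (metis the_equality)
  qed simp
  have "definable (\<lambda>e. R (e 0) (\<lambda>i. e (Suc (Suc i))))"
    by (rule definable_rename_eq[OF R, of _ "\<lambda>i. if i = 0 then 0 else Suc i"]) (auto simp: inj_def)
  then show ?thesis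
    unfolding definable_term_def * by (intro dfn R)
qed

section \<open>Sets, pairs and functions\<close>

definition is_set :: "'a set \<Rightarrow> bool" where
  "is_set A \<longleftrightarrow> (\<exists>x. elts x = A)"

text \<open>
  Definable for every definable \<open>A\<close>, even when \<open>A\<close> is not a set of the model; so terms that contain
  it can be shown to be definable without proving that the sets exist.
\<close>

definition the_set :: "'a set \<Rightarrow> 'a" where
  "the_set A = (THE x. elts x = A)"

definition pair :: "'a \<Rightarrow> 'a \<Rightarrow> 'a" where
  "pair a b = the_set {the_set {a}, the_set {a, b}}"

lemma definable_is_pair [dfn]:
  "definable_term p \<Longrightarrow> definable_term a \<Longrightarrow> definable_term b \<Longrightarrow>
    definable (\<lambda>e. is_pair (p e) (a e) (b e))"
  by (rule definable3[of is_pair], unfold is_pair_def) (intro dfn)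

lemma definable_graph_of [dfn]:
  "definable_term x \<Longrightarrow> definable_term y \<Longrightarrow> definable_term f \<Longrightarrow>
    definable (\<lambda>e. (x e, y e) \<in> graph_of (f e))"
  by (rule definable3[of "\<lambda>x y f. (x, y) \<in> graph_of f"], unfold graph_of_def mem_Collect_eq prod.case)
    (intro dfn)

lemma definable_set_Image [dfn]:
  "definable_term f \<Longrightarrow> definable_set A \<Longrightarrow> definable_set (\<lambda>e. graph_of (f e) `` A e)"
  unfolding Image_def by (intro dfn definable_shift definable_set_shift)

lemma definable_is_Union [dfn]:
  "definable_term u \<Longrightarrow> definable_term S \<Longrightarrow> definable (\<lambda>e. is_Union (u e) (S e))"
  by (rule definable2[of is_Union], unfold is_Union_def UNION_eq) (intro dfn)

lemma definable_maps [dfn]: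
  "definable_term f \<Longrightarrow> definable_term X \<Longrightarrow> definable_term Y \<Longrightarrow>
    definable (\<lambda>e. maps (f e) (X e) (Y e))"
  by (rule definable3[of maps], unfold maps_def Ex1_def) (intro dfn)

lemma definable_injective [dfn]: "definable_term f \<Longrightarrow> definable (\<lambda>e. injective (f e))"
  by (rule definable1[of injective], unfold injective_def) (intro dfn)

lemma definable_equipotent [dfn]:
  "definable_term X \<Longrightarrow> definable_term Y \<Longrightarrow> definable (\<lambda>e. equipotent (X e) (Y e))"
  by (rule definable2[of equipotent], unfold equipotent_def) (intro dfn)

lemma definable_is_inductive [dfn]: "definable_term w \<Longrightarrow> definable (\<lambda>e. is_inductive (w e))"
  by (rule definable1[of is_inductive], unfold is_inductive_def is_succ_def) (intro dfn)

lemma definable_finite_set [dfn]: "definable_term X \<Longrightarrow> definable (\<lambda>e. finite_set (X e))"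
  by (rule definable1[of finite_set], unfold finite_set_def is_omega_def) (intro dfn)

lemma definable_clopen_in [dfn]:
  "definable_term X \<Longrightarrow> definable_term T \<Longrightarrow> definable_term c \<Longrightarrow>
    definable (\<lambda>e. clopen_in (X e) (T e) (c e))"
  by (rule definable3[of clopen_in], unfold clopen_in_def closed_in_def) (intro dfn)

lemma definable_topology_on [dfn]:
  "definable_term X \<Longrightarrow> definable_term T \<Longrightarrow> definable (\<lambda>e. topology_on (X e) (T e))"
  by (rule definable2[of topology_on], unfold topology_on_def) (intro dfn)

end

context ZF_model
begin

lemma is_set_elts [simp]: "is_set (elts x)"
  by (auto simp: is_set_def)

lemma the_set_elts [simp]: "the_set (elts x) = x"
  unfolding the_set_def by (rule the_equality) (auto intro: extensionality)

lemma elts_the_set [simp]: "is_set A \<Longrightarrow> elts (the_set A) = A"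
  by (auto simp: is_set_def)

lemma elts_eq_iff: "elts x = elts y \<longleftrightarrow> x = y"
  by (auto intro: extensionality)

lemma definable_the_set [dfn]: "definable_set A \<Longrightarrow> definable_term (\<lambda>e. the_set (A e))"
  unfolding the_set_def
  by (rule definable_term_The) (intro dfn definable_set_shift, assumption, simp add: elts_eq_iff[symmetric])

text \<open>
  Separation in the form in which it is used: a definable collection inside a set is a set.
\<close>

lemma is_set_separation:
  assumes "A \<subseteq> elts x" "definable_set (\<lambda>e. A)"
  shows "is_set A"
proof -
  obtain \<phi> c where *: "\<And>e. e 0 \<in> A \<longleftrightarrow> sat \<phi> (interleave e c)"
    using assms(2) by (auto simp: definable_def definable_set_def)
  obtain y where y: "elts y = {z \<in> elts x. sat \<phi> ((interleave (\<lambda>_. x) c)(0 := z))}"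
    using separation by blast
  have "(interleave (\<lambda>_. x) c)(0 := z) = interleave ((\<lambda>_. x)(0 := z)) c" for z
    by (auto simp: interleave_def fun_eq_iff elim!: evenE)
  then have "elts y = A"
    using assms(1) *[of "(\<lambda>_. x)(0 := _)"] by (auto simp: y)
  then show ?thesis by (auto simp: is_set_def)
qed

lemma is_set_Collect:
  "definable (\<lambda>e. P (e 0)) \<Longrightarrow> is_set {z \<in> elts x. P z}"
  by (rule is_set_separation[of _ x]) (blast, intro dfn)

text \<open>
  In the axiom, argument and value are the variables \<open>0\<close> and \<open>1\<close>; for a definable term they
  are the even variables \<open>2\<close> and \<open>0\<close>. The three variables are permuted cyclically.
\<close>

lemma is_set_image:
  assumes "definable_term (\<lambda>e. F (e 0))"
  shows "is_set (F ` elts x)"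
proof -
  obtain \<phi> c where *: "\<And>e. e 0 = F (e 1) \<longleftrightarrow> sat \<phi> (interleave e c)"
    using assms by (auto simp: definable_def definable_term_def)
  define q :: "nat \<Rightarrow> nat" where "q i = (if i = 0 then 1 else if i = 1 then 2 else if i = 2 then 0 else i)" for i
  have "inj q" by (auto simp: inj_def q_def split: if_splits)
  define \<rho> where "\<rho> = (\<lambda>i. if i = 2 then c 0 else interleave (\<lambda>_. x) c i)"
  have "\<rho>(0 := z, 1 := y) \<circ> q = interleave ((\<lambda>_. x)(0 := y, 1 := z)) c" for y z
    by (auto simp: interleave_def fun_eq_iff q_def \<rho>_def elim!: evenE)
  then have eq: "sat (rename q \<phi>) (\<rho>(0 := z, 1 := y)) \<longleftrightarrow> y = F z" for y z
    unfolding sat_rename[OF \<open>inj q\<close>] using *[of "(\<lambda>_. x)(0 := y, 1 := z)"] by simp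
  obtain r where "elts r = {y. \<exists>z\<in>elts x. sat (rename q \<phi>) (\<rho>(0 := z, 1 := y))}"
    using replacement[of x "rename q \<phi>" \<rho>] unfolding eq by blast
  then show ?thesis unfolding eq is_set_def by (auto intro!: exI[of _ r])
qed

lemma is_set_pair [simp]: "is_set {a, b}" and is_set_singleton [simp]: "is_set {a}"
  using pairing[of a b] pairing[of a a] by (auto simp: is_set_def)

lemma is_set_empty [simp]: "is_set {}"
  by (rule is_set_separation) (blast, intro dfn)

lemma is_set_UN: "is_set (\<Union>x\<in>elts S. elts x)"
  using union[of S] by (auto simp: is_set_def is_Union_def)

lemma is_set_Un [simp]: "is_set A \<Longrightarrow> is_set B \<Longrightarrow> is_set (A \<union> B)"
  using is_set_UN[of "the_set {the_set A, the_set B}"] by simp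

lemma is_set_insert [simp]: "is_set A \<Longrightarrow> is_set (insert a A)"
  using is_set_Un[of "{a}" A] by simp

lemma is_set_Int [simp]: "is_set A \<Longrightarrow> is_set B \<Longrightarrow> is_set (A \<inter> B)"
  and is_set_Diff [simp]: "is_set A \<Longrightarrow> is_set B \<Longrightarrow> is_set (A - B)"
proof -
  assume "is_set A" "is_set B"
  moreover have "is_set {z \<in> elts (the_set A). z \<in> elts (the_set B)}"
    "is_set {z \<in> elts (the_set A). z \<notin> elts (the_set B)}"
    by (rule is_set_Collect, intro dfn)+
  ultimately show "is_set (A \<inter> B)" "is_set (A - B)"
    by (simp_all add: Int_def set_diff_eq)
qed

lemma is_set_Pow [simp]: "is_set {y. elts y \<subseteq> elts x}"
  using powerset[of x] by (auto simp: is_set_def)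

lemma mem_irrefl: "x \<notin> elts x"
  using foundation[of "the_set {x}"] by auto

lemma is_pair_iff: "is_pair p a b \<longleftrightarrow> p = pair a b"
proof
  assume "is_pair p a b"
  then obtain s d where "elts s = {a}" "elts d = {a, b}" "elts p = {s, d}"
    by (auto simp: is_pair_def)
  then show "p = pair a b" unfolding pair_def by (metis the_set_elts)
next
  assume "p = pair a b"
  then show "is_pair p a b"
    unfolding is_pair_def pair_def
    by (intro exI[of _ "the_set {a}"] exI[of _ "the_set {a, b}"]) simp
qed

lemma pair_inject [simp]: "pair a b = pair c d \<longleftrightarrow> a = c \<and> b = d"
proof -
  have the_set_inject: "the_set A = the_set B \<longleftrightarrow> A = B" if "is_set A" "is_set B" for A B
    using that elts_the_set by metis
  show ?thesis
    by (auto simp: pair_def the_set_inject doubleton_eq_iff)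
qed

lemma definable_pair [dfn]:
  "definable_term s \<Longrightarrow> definable_term t \<Longrightarrow> definable_term (\<lambda>e. pair (s e) (t e))"
  by (rule definable_term2[of pair], unfold pair_def) (intro dfn)

lemma in_graph_of_iff [simp]: "(x, y) \<in> graph_of f \<longleftrightarrow> pair x y \<in> elts f"
  by (auto simp: graph_of_def is_pair_iff)

lemma is_set_times: "is_set {p. \<exists>x\<in>elts X. \<exists>y\<in>elts Y. p = pair x y}"
proof -
  obtain U P Q where "elts U = elts X \<union> elts Y" "elts P = {y. elts y \<subseteq> elts U}"
    "elts Q = {y. elts y \<subseteq> elts P}"
    by (metis elts_the_set is_set_Pow is_set_Un is_set_elts)
  then have "{p. \<exists>x\<in>elts X. \<exists>y\<in>elts Y. p = pair x y} \<subseteq> elts Q"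
    by (auto simp: pair_def)
  then show ?thesis by (rule is_set_separation) (intro dfn)
qed

lemma maps_iff:
  "maps f X Y \<longleftrightarrow> (\<forall>p\<in>elts f. \<exists>x\<in>elts X. \<exists>y\<in>elts Y. p = pair x y) \<and>
    (\<forall>x\<in>elts X. \<exists>!y. pair x y \<in> elts f)"
  by (auto simp: maps_def is_pair_iff)

definition mkfun :: "'a \<Rightarrow> ('a \<Rightarrow> 'a) \<Rightarrow> 'a" where
  "mkfun X F = the_set ((\<lambda>x. pair x (F x)) ` elts X)"

lemma elts_mkfun:
  assumes "definable_term (\<lambda>e. F (e 0))"
  shows "elts (mkfun X F) = (\<lambda>x. pair x (F x)) ` elts X"
  unfolding mkfun_def
  by (intro elts_the_set is_set_image dfn definable_term1[OF assms])

lemma pair_in_mkfun: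
  "definable_term (\<lambda>e. F (e 0)) \<Longrightarrow> pair x y \<in> elts (mkfun X F) \<longleftrightarrow> x \<in> elts X \<and> y = F x"
  by (auto simp: elts_mkfun)

lemma maps_mkfun:
  "definable_term (\<lambda>e. F (e 0)) \<Longrightarrow> (\<And>x. x \<in> elts X \<Longrightarrow> F x \<in> elts Y) \<Longrightarrow> maps (mkfun X F) X Y"
  by (auto simp: maps_iff pair_in_mkfun elts_mkfun)

text \<open>
  This agrees with \<^const>\<open>val\<close> for functions and arguments in their domain. Being the union of all values, it is visibly definable
  whether or not \<open>f\<close> is a function.
\<close>

definition app :: "'a \<Rightarrow> 'a \<Rightarrow> 'a" where
  "app f x = the_set {z. \<exists>y. pair x y \<in> elts f \<and> z \<in> elts y}"

lemma definable_app [dfn]: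
  "definable_term s \<Longrightarrow> definable_term t \<Longrightarrow> definable_term (\<lambda>e. app (s e) (t e))"
  by (rule definable_term2[of app], unfold app_def) (intro dfn)

lemma app_eq:
  assumes "maps f X Y" "pair x y \<in> elts f"
  shows "app f x = y"
proof -
  have "x \<in> elts X" using assms by (fastforce simp: maps_iff)
  then have "pair x y' \<in> elts f \<longleftrightarrow> y' = y" for y'
    using assms by (auto simp: maps_iff)
  then show ?thesis by (simp add: app_def)
qed

lemma pair_in_fun_iff:
  assumes "maps f X Y"
  shows "pair x y \<in> elts f \<longleftrightarrow> x \<in> elts X \<and> y = app f x"
proof
  assume a: "pair x y \<in> elts f"
  then show "x \<in> elts X \<and> y = app f x"
    using app_eq[OF assms a] assms by (fastforce simp: maps_iff)
next
  assume a: "x \<in> elts X \<and> y = app f x"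
  then obtain y' where "pair x y' \<in> elts f" using assms by (auto simp: maps_iff)
  then show "pair x y \<in> elts f" using a app_eq[OF assms] by simp
qed

lemma app_in: "maps f X Y \<Longrightarrow> x \<in> elts X \<Longrightarrow> app f x \<in> elts Y"
  using pair_in_fun_iff[of f X Y x "app f x"] by (fastforce simp: maps_iff)

lemma app_mkfun:
  "definable_term (\<lambda>e. F (e 0)) \<Longrightarrow> x \<in> elts X \<Longrightarrow> app (mkfun X F) x = F x"
  by (rule app_eq[OF maps_mkfun[where Y = "the_set (F ` elts X)"]])
    (auto simp: pair_in_mkfun is_set_image)

lemma val_eq: "maps f X Y \<Longrightarrow> x \<in> elts X \<Longrightarrow> val f x = app f x"
  by (simp add: val_def pair_in_fun_iff)

lemma Image_fun: "maps f X Y \<Longrightarrow> A \<subseteq> elts X \<Longrightarrow> graph_of f `` A = app f ` A"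
  by (auto simp: Image_def pair_in_fun_iff image_iff)

lemma vimage_fun: "maps f X Y \<Longrightarrow> (graph_of f)\<inverse> `` A = {x \<in> elts X. app f x \<in> A}"
  by (auto simp: Image_def pair_in_fun_iff)

lemma injective_iff: "maps f X Y \<Longrightarrow> injective f \<longleftrightarrow> inj_on (app f) (elts X)"
  by (auto simp: injective_def pair_in_fun_iff inj_on_def) 

section \<open>Finite sets\<close>

lemma omega_exists: "\<exists>w. is_omega w"
proof -
  obtain w0 where w0: "is_inductive w0" using infinity by blast
  define w where "w = the_set {x \<in> elts w0. \<forall>v. is_inductive v \<longrightarrow> x \<in> elts v}"
  have w: "elts w = {x \<in> elts w0. \<forall>v. is_inductive v \<longrightarrow> x \<in> elts v}"
    unfolding w_def by (intro elts_the_set is_set_Collect dfn)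
  have "is_inductive w"
    unfolding is_inductive_def
  proof (intro conjI ballI)
    obtain z where z: "z \<in> elts w0" "elts z = {}" using w0 by (auto simp: is_inductive_def)
    have "z \<in> elts v" if "is_inductive v" for v
      using that z extensionality unfolding is_inductive_def by metis
    then show "\<exists>z\<in>elts w. elts z = {}" using z w by auto
  next
    fix x assume x: "x \<in> elts w"
    then obtain s where s: "s \<in> elts w0" "is_succ s x" using w0 w by (auto simp: is_inductive_def)
    have "s \<in> elts v" if v: "is_inductive v" for v
    proof -
      have "x \<in> elts v" using x v w by auto
      then obtain s' where "s' \<in> elts v" "is_succ s' x" using v by (auto simp: is_inductive_def)
      then show ?thesis using s extensionality[of s s'] by (simp add: is_succ_def)
    qed
    then show "\<exists>s\<in>elts w. is_succ s x" using s w by auto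
  qed
  then show ?thesis unfolding is_omega_def using w by auto
qed

text \<open>
  The members of \<open>w\<close> that satisfy \<open>P\<close> form an inductive set of the model, as \<open>P\<close> is definable.
\<close>

lemma omega_induct:
  assumes w: "is_omega w" and n: "n \<in> elts w" and P: "definable (\<lambda>e. P (e 0))"
    and zero: "\<And>z. elts z = {} \<Longrightarrow> P z"
    and succ: "\<And>x s. P x \<Longrightarrow> is_succ s x \<Longrightarrow> P s"
  shows "P n"
proof -
  define v where "v = the_set {x \<in> elts w. P x}"
  have v: "elts v = {x \<in> elts w. P x}"
    unfolding v_def by (intro elts_the_set is_set_Collect P)
  have w': "is_inductive w" using w by (simp add: is_omega_def)
  have "is_inductive v"
    unfolding is_inductive_def v
  proof (intro conjI ballI)
    show "\<exists>z\<in>{x \<in> elts w. P x}. elts z = {}"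
      using w' zero by (auto simp: is_inductive_def)
    fix x assume "x \<in> {x \<in> elts w. P x}"
    then obtain s where "s \<in> elts w" "is_succ s x" "P x" using w' by (auto simp: is_inductive_def)
    then show "\<exists>s\<in>{x \<in> elts w. P x}. is_succ s x" using succ by blast
  qed
  then show "P n" using w n v by (auto simp: is_omega_def)
qed

lemma equipotent_iff: "equipotent X Y \<longleftrightarrow> (\<exists>f. maps f X Y \<and> bij_betw (app f) (elts X) (elts Y))"
  unfolding equipotent_def bij_betw_def
  by (intro ex_cong1 conj_cong refl) (simp_all add: injective_iff Image_fun)

lemma equipotentI:
  assumes "definable_term (\<lambda>e. F (e 0))" "bij_betw F (elts X) (elts Y)"
  shows "equipotent X Y"
  unfolding equipotent_iff
proof (intro exI conjI)
  show "maps (mkfun X F) X Y"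
    using assms(2) by (intro maps_mkfun[OF assms(1)]) (auto simp: bij_betw_def)
  show "bij_betw (app (mkfun X F)) (elts X) (elts Y)"
    using assms(2) by (rule bij_betw_cong[THEN iffD1, rotated]) (simp add: app_mkfun[OF assms(1)])
qed

lemma finite_set_empty: "elts X = {} \<Longrightarrow> finite_set X"
proof -
  assume X: "elts X = {}"
  obtain w where w: "is_omega w" using omega_exists by blast
  then obtain z where "z \<in> elts w" "elts z = {}" by (auto simp: is_omega_def is_inductive_def)
  then show ?thesis
    unfolding finite_set_def using X w by (intro exI[of _ w] conjI bexI[of _ z] equipotentI[of "\<lambda>x. x"] dfn)
      (auto simp: bij_betw_def)
qed

lemma finite_set_insert:
  assumes "finite_set X" "elts Y = insert a (elts X)"
  shows "finite_set Y"
proof (cases "a \<in> elts X")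
  case True
  then have "elts Y = elts X" using assms(2) by auto
  then show ?thesis using assms(1) elts_eq_iff by simp
next
  case False
  obtain w n f where w: "is_omega w" "n \<in> elts w" "maps f X n" "bij_betw (app f) (elts X) (elts n)"
    using assms(1) by (auto simp: finite_set_def equipotent_iff)
  obtain s where s: "s \<in> elts w" "elts s = insert n (elts n)"
    using w(1,2) by (auto simp: is_omega_def is_inductive_def is_succ_def)
  define F where "F x = (if x = a then n else app f x)" for x
  have "bij_betw F (elts X) (elts n)"
    using w(4) by (rule bij_betw_cong[THEN iffD1, rotated]) (use False in \<open>auto simp: F_def\<close>)
  then have "bij_betw F (insert a (elts X)) (insert (F a) (elts n))"
    using False mem_irrefl[of n] by (subst notIn_Un_bij_betw3[symmetric, unfolded Un_insert_right Un_empty_right]) (auto simp: F_def)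
  then have "bij_betw F (elts Y) (elts s)" using s assms(2) by (simp add: F_def)
  then have "equipotent Y s" by (rule equipotentI[rotated]) (unfold F_def, intro dfn)
  then show ?thesis using w s by (auto simp: finite_set_def)
qed

text \<open>
  Induction on the number of elements: remove the element that a bijection sends to the last number.
\<close>

lemma finite_set_induct [consumes 1, case_names definable empty insert]:
  assumes X: "finite_set X" and P: "definable (\<lambda>e. P (e 0))"
    and empty: "\<And>Z. elts Z = {} \<Longrightarrow> P Z"
    and insert: "\<And>F a G. finite_set F \<Longrightarrow> P F \<Longrightarrow> a \<notin> elts F \<Longrightarrow> elts G = insert a (elts F) \<Longrightarrow> P G"
  shows "P X"
proof -
  obtain w n where w: "is_omega w" "n \<in> elts w" "equipotent X n"
    using X by (auto simp: finite_set_def)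
  have "\<forall>X. equipotent X n \<longrightarrow> finite_set X \<and> P X"
    using w(1,2)
  proof (rule omega_induct)
    show "definable (\<lambda>e. \<forall>X. equipotent X (e 0) \<longrightarrow> finite_set X \<and> P X)"
      by (intro dfn definable1[OF P])
  next
    fix z assume "elts z = {}"
    then show "\<forall>X. equipotent X z \<longrightarrow> finite_set X \<and> P X"
      using empty finite_set_empty by (auto simp: equipotent_iff bij_betw_def)
  next
    fix x s assume IH: "\<forall>X. equipotent X x \<longrightarrow> finite_set X \<and> P X" and "is_succ s x"
    then have s: "elts s = insert x (elts x)" by (simp add: is_succ_def)
    show "\<forall>X. equipotent X s \<longrightarrow> finite_set X \<and> P X"
    proof (intro allI impI)
      fix X assume "equipotent X s"
      then obtain f where f: "bij_betw (app f) (elts X) (elts s)" by (auto simp: equipotent_iff)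
      then obtain a where a: "a \<in> elts X" "app f a = x"
        using s by (metis bij_betw_imp_surj_on image_iff insertI1)
      define Y where "Y = the_set (elts X - {a})"
      have Y: "elts Y = elts X - {a}" by (simp add: Y_def)
      have "bij_betw (app f) (elts Y) (elts s - {x})"
        using f a unfolding Y bij_betw_def by (auto simp: inj_on_def image_iff)
      moreover have "elts s - {x} = elts x" using s mem_irrefl[of x] by auto
      ultimately have "equipotent Y x" by (intro equipotentI[of "app f"] dfn) simp
      then have "finite_set Y" "P Y" using IH by auto
      moreover have "elts X = insert a (elts Y)" "a \<notin> elts Y" using Y a by auto
      ultimately show "finite_set X \<and> P X" using insert finite_set_insert by blast
    qed
  qed
  then show ?thesis using w by blast
qed

lemma finite_set_Un:
  assumes "finite_set X" "finite_set Y" "elts Z = elts X \<union> elts Y"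
  shows "finite_set Z"
proof -
  have "\<forall>Z. elts Z = elts X \<union> elts Y \<longrightarrow> finite_set Z"
    using assms(1)
  proof (induction rule: finite_set_induct)
    case definable
    show ?case by (intro dfn)
  next
    case (empty Z)
    then show ?case using assms(2) by (auto simp: elts_eq_iff)
  next
    case (insert F a G)
    show ?case
    proof (intro allI impI)
      fix Z assume "elts Z = elts G \<union> elts Y"
      then have "elts Z = insert a (elts (the_set (elts F \<union> elts Y)))"
        using insert by simp
      moreover have "finite_set (the_set (elts F \<union> elts Y))" using insert.IH by simp
      ultimately show "finite_set Z" by (rule finite_set_insert[rotated])
    qed
  qed
  then show ?thesis using assms by blast
qed

lemma finite_set_subset:
  assumes "finite_set X" "elts Y \<subseteq> elts X"
  shows "finite_set Y"
proof -
  have "\<forall>Y. elts Y \<subseteq> elts X \<longrightarrow> finite_set Y"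
    using assms(1)
  proof (induction rule: finite_set_induct)
    case definable
    show ?case by (intro dfn)
  next
    case (empty Z)
    then show ?case by (auto intro: finite_set_empty)
  next
    case (insert F a G)
    show ?case
    proof (intro allI impI)
      fix Y assume Y: "elts Y \<subseteq> elts G"
      have "finite_set (the_set (elts Y - {a}))"
        using insert Y by (intro insert.IH[rule_format]) auto
      then show "finite_set Y"
      proof (cases "a \<in> elts Y")
        case True
        then show ?thesis
          using \<open>finite_set (the_set (elts Y - {a}))\<close> by (intro finite_set_insert[of _ Y a]) auto
      next
        case False
        then show ?thesis using \<open>finite_set (the_set (elts Y - {a}))\<close> by simp
      qed
    qed
  qed
  then show ?thesis using assms by blast
qed

lemma finite_set_doubleton: "elts X = {a, b} \<Longrightarrow> finite_set X"
  using finite_set_insert[of "the_set {b}" X a] finite_set_insert[of "the_set {}" "the_set {b}" b]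
    finite_set_empty[of "the_set {}"] by simp

text \<open>
  A nonempty finite set has a member that is maximal for inclusion, while in an inductive set every
  member is properly contained in its successor.
\<close>

lemma inductive_infinite:
  assumes w: "is_inductive w"
  shows "\<not> finite_set w"
proof
  assume "finite_set w"
  then have "elts w \<noteq> {} \<longrightarrow> (\<exists>x\<in>elts w. \<forall>y\<in>elts w. elts x \<subseteq> elts y \<longrightarrow> x = y)"
  proof (induction rule: finite_set_induct)
    case definable
    show ?case by (intro dfn)
  next
    case (insert F a G)
    note G = \<open>elts G = insert a (elts F)\<close>
    show ?case
    proof (cases "elts F = {}")
      case False
      then obtain x where x: "x \<in> elts F" "\<forall>y\<in>elts F. elts x \<subseteq> elts y \<longrightarrow> x = y"
        using insert.IH by auto
      show ?thesis
      proof (cases "elts x \<subseteq> elts a")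
        case True
        have "\<forall>y\<in>elts F. elts a \<subseteq> elts y \<longrightarrow> a = y"
        proof (intro ballI impI)
          fix y assume y: "y \<in> elts F" "elts a \<subseteq> elts y"
          have "elts x \<subseteq> elts y" using True y(2) by (rule subset_trans)
          then have "x = y" by (rule x(2)[rule_format, OF y(1)])
          with True have "elts y \<subseteq> elts a" by blast
          with y(2) have "elts a = elts y" by (rule subset_antisym)
          then show "a = y" by (rule extensionality)
        qed
        then have "\<forall>y\<in>elts G. elts a \<subseteq> elts y \<longrightarrow> a = y"
          using G by auto
        then show ?thesis by (intro impI bexI[of _ a]) (simp_all add: G)
      next
        case False
        then have "\<forall>y\<in>elts G. elts x \<subseteq> elts y \<longrightarrow> x = y"
          unfolding G using x(2) by blast
        then show ?thesis by (intro impI bexI[of _ x]) (simp_all add: G x(1))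
      qed
    next
      case True
      then show ?thesis using G by simp
    qed
  qed simp
  then obtain x where x: "x \<in> elts w" "\<forall>y\<in>elts w. elts x \<subseteq> elts y \<longrightarrow> x = y"
    using w by (auto simp: is_inductive_def)
  then obtain s where "s \<in> elts w" "elts s = insert x (elts x)"
    using w by (auto simp: is_inductive_def is_succ_def)
  then show False using x mem_irrefl[of x] by auto
qed

text \<open>
  Lets a Boolean algebra, finite or not, be placed inside an infinite set.
\<close>

lemma infinite_superset_exists: "\<exists>J. elts X \<subseteq> elts J \<and> \<not> finite_set J"
proof -
  obtain w where w: "is_inductive w" using infinity by blast
  have "\<not> finite_set (the_set (elts X \<union> elts w))"
    using inductive_infinite[OF w] finite_set_subset[of "the_set (elts X \<union> elts w)" w] by auto
  then show ?thesis by (intro exI[of _ "the_set (elts X \<union> elts w)"]) auto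
qed

section \<open>Ultrafilters from the Boolean prime ideal theorem\<close>

definition mkop :: "'a \<Rightarrow> ('a \<Rightarrow> 'a \<Rightarrow> 'a) \<Rightarrow> 'a" where
  "mkop B F = the_set {r. \<exists>x\<in>elts B. \<exists>y\<in>elts B. r = pair (pair x y) (F x y)}"

lemma mkop:
  assumes F: "definable_term (\<lambda>e. F (e 0) (e (Suc 0)))"
    and closed: "\<And>x y. x \<in> elts B \<Longrightarrow> y \<in> elts B \<Longrightarrow> F x y \<in> elts B"
  shows "binary_operation (mkop B F) B"
    and "x \<in> elts B \<Longrightarrow> y \<in> elts B \<Longrightarrow> val2 (mkop B F) x y = F x y"
proof -
  define P where "P = the_set {p. \<exists>x\<in>elts B. \<exists>y\<in>elts B. p = pair x y}"
  have P: "elts P = {p. \<exists>x\<in>elts B. \<exists>y\<in>elts B. p = pair x y}"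
    unfolding P_def by (intro elts_the_set is_set_times)
  define D where "D = {r. \<exists>x\<in>elts B. \<exists>y\<in>elts B. r = pair (pair x y) (F x y)}"
  have "D \<subseteq> elts (the_set {r. \<exists>p\<in>elts P. \<exists>y\<in>elts B. r = pair p y})"
    unfolding elts_the_set[OF is_set_times] D_def
  proof (rule subsetI, unfold mem_Collect_eq, elim bexE)
    fix r x y assume xy: "x \<in> elts B" "y \<in> elts B" and r: "r = pair (pair x y) (F x y)"
    have "pair x y \<in> elts P" using xy by (auto simp: P)
    with r closed[OF xy] show "\<exists>p\<in>elts P. \<exists>y\<in>elts B. r = pair p y" by (intro bexI)
  qed
  then have "is_set D"
    by (rule is_set_separation) (unfold D_def, intro dfn definable_term2[OF F])
  then have op: "elts (mkop B F) = D" by (simp add: mkop_def D_def)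
  have maps: "maps (mkop B F) P B"
    unfolding maps_iff op P D_def using closed by auto
  then show "binary_operation (mkop B F) B"
    unfolding binary_operation_def is_pair_iff using P by blast
  show "val2 (mkop B F) x y = F x y" if "x \<in> elts B" "y \<in> elts B"
  proof -
    have "pair (pair x y) (F x y) \<in> elts (mkop B F)"
      using that by (auto simp: op D_def)
    then show ?thesis
      using that val_eq[OF maps] app_eq[OF maps] unfolding val2_def is_pair_iff P by auto
  qed
qed

text \<open>
  BPI for an algebra whose operations are definable HOL functions rather than sets of pairs.
\<close>

lemma BPI_prime_ideal:
  assumes BPI
    and F: "definable_term (\<lambda>e. jn (e 0) (e (Suc 0)))" "definable_term (\<lambda>e. mt (e 0) (e (Suc 0)))"
      "definable_term (\<lambda>e. cp (e 0))"
    and closed: "\<And>x y. x \<in> elts B \<Longrightarrow> y \<in> elts B \<Longrightarrow> jn x y \<in> elts B"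
      "\<And>x y. x \<in> elts B \<Longrightarrow> y \<in> elts B \<Longrightarrow> mt x y \<in> elts B"
      "\<And>x. x \<in> elts B \<Longrightarrow> cp x \<in> elts B" "bt \<in> elts B" "tp \<in> elts B"
    and "bt \<noteq> tp"
    and laws: "\<And>x y. x \<in> elts B \<Longrightarrow> y \<in> elts B \<Longrightarrow> jn x y = jn y x"
      "\<And>x y. x \<in> elts B \<Longrightarrow> y \<in> elts B \<Longrightarrow> mt x y = mt y x"
      "\<And>x y. x \<in> elts B \<Longrightarrow> y \<in> elts B \<Longrightarrow> jn x (mt x y) = x"
      "\<And>x y. x \<in> elts B \<Longrightarrow> y \<in> elts B \<Longrightarrow> mt x (jn x y) = x"
      "\<And>x y z. x \<in> elts B \<Longrightarrow> y \<in> elts B \<Longrightarrow> z \<in> elts B \<Longrightarrow> jn x (jn y z) = jn (jn x y) z"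
      "\<And>x y z. x \<in> elts B \<Longrightarrow> y \<in> elts B \<Longrightarrow> z \<in> elts B \<Longrightarrow> mt x (mt y z) = mt (mt x y) z"
      "\<And>x y z. x \<in> elts B \<Longrightarrow> y \<in> elts B \<Longrightarrow> z \<in> elts B \<Longrightarrow> mt x (jn y z) = jn (mt x y) (mt x z)"
      "\<And>x y z. x \<in> elts B \<Longrightarrow> y \<in> elts B \<Longrightarrow> z \<in> elts B \<Longrightarrow> jn x (mt y z) = mt (jn x y) (jn x z)"
      "\<And>x. x \<in> elts B \<Longrightarrow> jn x (cp x) = tp"
      "\<And>x. x \<in> elts B \<Longrightarrow> mt x (cp x) = bt"
  obtains I where "elts I \<subseteq> elts B" "bt \<in> elts I" "tp \<notin> elts I"
    "\<And>x y. x \<in> elts I \<Longrightarrow> y \<in> elts I \<Longrightarrow> jn x y \<in> elts I"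
    "\<And>x y. x \<in> elts I \<Longrightarrow> y \<in> elts B \<Longrightarrow> mt x y = y \<Longrightarrow> y \<in> elts I"
    "\<And>x y. x \<in> elts B \<Longrightarrow> y \<in> elts B \<Longrightarrow> mt x y \<in> elts I \<Longrightarrow> x \<in> elts I \<or> y \<in> elts I"
proof -
  note j = mkop[of jn B, OF F(1) closed(1)] and m = mkop[of mt B, OF F(2) closed(2)]
  have c: "maps (mkfun B cp) B B" by (intro maps_mkfun F closed)
  have c': "val (mkfun B cp) x = cp x" if "x \<in> elts B" for x
    using val_eq[OF c that] app_mkfun[OF F(3) that] by simp
  have "boolean_algebra B (mkop B jn) (mkop B mt) (mkfun B cp) bt tp"
    unfolding boolean_algebra_def
    by (intro conjI ballI j(1) m(1) c closed \<open>bt \<noteq> tp\<close>;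
        simp only: j(2) m(2) c' closed; rule laws; assumption)
  then obtain I where I: "prime_ideal I B (mkop B jn) (mkop B mt) bt tp"
    using \<open>BPI\<close> unfolding BPI_def by blast
  then have sub: "elts I \<subseteq> elts B" by (simp add: prime_ideal_def)
  show ?thesis
  proof (rule that[of I])
    show "elts I \<subseteq> elts B" "bt \<in> elts I" "tp \<notin> elts I"
      using I by (simp_all add: prime_ideal_def)
    show "jn x y \<in> elts I" if "x \<in> elts I" "y \<in> elts I" for x y
      using I that subsetD[OF sub] unfolding prime_ideal_def by (metis j(2))
    show "y \<in> elts I" if "x \<in> elts I" "y \<in> elts B" "mt x y = y" for x y
      using I that subsetD[OF sub] unfolding prime_ideal_def by (metis m(2))
    show "x \<in> elts I \<or> y \<in> elts I" if "x \<in> elts B" "y \<in> elts B" "mt x y \<in> elts I" for x y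
      using I that unfolding prime_ideal_def by (metis m(2))
  qed
qed

definition cup :: "'a \<Rightarrow> 'a \<Rightarrow> 'a" where "cup c d = the_set (elts c \<union> elts d)"
definition cap :: "'a \<Rightarrow> 'a \<Rightarrow> 'a" where "cap c d = the_set (elts c \<inter> elts d)"
definition diff :: "'a \<Rightarrow> 'a \<Rightarrow> 'a" where "diff c d = the_set (elts c - elts d)"
definition emp :: 'a where "emp = the_set {}"

lemma elts_set_ops [simp]:
  "elts (cup c d) = elts c \<union> elts d" "elts (cap c d) = elts c \<inter> elts d"
  "elts (diff c d) = elts c - elts d" "elts emp = {}"
  by (simp_all add: cup_def cap_def diff_def emp_def)

lemma definable_set_ops [dfn]:
  "definable_term s \<Longrightarrow> definable_term t \<Longrightarrow> definable_term (\<lambda>e. cup (s e) (t e))"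
  "definable_term s \<Longrightarrow> definable_term t \<Longrightarrow> definable_term (\<lambda>e. cap (s e) (t e))"
  "definable_term s \<Longrightarrow> definable_term t \<Longrightarrow> definable_term (\<lambda>e. diff (s e) (t e))"
  unfolding cup_def cap_def diff_def by (intro dfn; assumption)+

definition set_algebra :: "'a \<Rightarrow> 'a \<Rightarrow> bool" where
  "set_algebra X B \<longleftrightarrow> X \<in> elts B \<and> (\<forall>c\<in>elts B. elts c \<subseteq> elts X \<and> diff X c \<in> elts B) \<and>
     (\<forall>c\<in>elts B. \<forall>d\<in>elts B. cap c d \<in> elts B)"

definition ultrafilter :: "'a \<Rightarrow> 'a \<Rightarrow> 'a \<Rightarrow> bool" where
  "ultrafilter X B p \<longleftrightarrow> elts p \<subseteq> elts B \<and> X \<in> elts p \<and> emp \<notin> elts p \<and>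
     (\<forall>c\<in>elts p. \<forall>d\<in>elts p. cap c d \<in> elts p) \<and>
     (\<forall>c\<in>elts p. \<forall>d\<in>elts B. elts c \<subseteq> elts d \<longrightarrow> d \<in> elts p) \<and>
     (\<forall>c\<in>elts B. c \<in> elts p \<or> diff X c \<in> elts p)"

lemma cup_eq_de_Morgan:
  "elts c \<subseteq> elts X \<Longrightarrow> elts d \<subseteq> elts X \<Longrightarrow> cup c d = diff X (cap (diff X c) (diff X d))"
  by (intro extensionality) auto

lemma set_algebra_cup:
  assumes "set_algebra X B" "c \<in> elts B" "d \<in> elts B"
  shows "cup c d \<in> elts B"
  using assms cup_eq_de_Morgan[of c X d] by (simp add: set_algebra_def)

lemma set_algebra_empty: "set_algebra X B \<Longrightarrow> emp \<in> elts B"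
proof -
  assume "set_algebra X B"
  moreover have "emp = diff X X" by (intro extensionality) simp
  ultimately show ?thesis by (simp add: set_algebra_def)
qed

text \<open>
  BPI gives a prime ideal, but no control over it; the control comes from passing to the quotient by \<open>I\<close>.
  Its elements are the equivalence classes of the relation that the symmetric difference belongs to \<open>I\<close>,
  and the ultrafilter consists of the sets whose class is not in the prime ideal of the quotient.
\<close>

lemma ultrafilter_avoiding_ideal:
  assumes BPI and B: "set_algebra X B"
    and I: "elts I \<subseteq> elts B" "emp \<in> elts I" "X \<notin> elts I"
      "\<And>c d. c \<in> elts I \<Longrightarrow> d \<in> elts I \<Longrightarrow> cup c d \<in> elts I"
      "\<And>c d. c \<in> elts I \<Longrightarrow> d \<in> elts B \<Longrightarrow> elts d \<subseteq> elts c \<Longrightarrow> d \<in> elts I"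
  obtains p where "ultrafilter X B p" "elts p \<inter> elts I = {}"
proof -
  have X: "X \<in> elts B" and sub: "\<And>c. c \<in> elts B \<Longrightarrow> elts c \<subseteq> elts X"
    and cl: "\<And>c. c \<in> elts B \<Longrightarrow> diff X c \<in> elts B"
      "\<And>c d. c \<in> elts B \<Longrightarrow> d \<in> elts B \<Longrightarrow> cap c d \<in> elts B"
      "\<And>c d. c \<in> elts B \<Longrightarrow> d \<in> elts B \<Longrightarrow> cup c d \<in> elts B" "emp \<in> elts B"
    using B set_algebra_cup[OF B] set_algebra_empty[OF B] by (auto simp: set_algebra_def)
  have diffB: "diff c d \<in> elts B" if "c \<in> elts B" "d \<in> elts B" for c d
  proof -
    have "diff c d = cap c (diff X d)" using sub[OF that(1)] by (intro extensionality) auto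
    then show ?thesis using cl that by simp
  qed
  define sim where "sim c d \<longleftrightarrow> cup (diff c d) (diff d c) \<in> elts I" for c d
  have sim_dfn [dfn]: "definable_term s \<Longrightarrow> definable_term t \<Longrightarrow> definable (\<lambda>e. sim (s e) (t e))" for s t
    unfolding sim_def by (intro dfn)
  have simI: "sim c d" if "e \<in> elts I" "c \<in> elts B" "d \<in> elts B" "elts c \<subseteq> elts d \<union> elts e" "elts d \<subseteq> elts c \<union> elts e" for c d e
    unfolding sim_def using that by (intro I(5)[OF \<open>e \<in> elts I\<close>] cl diffB) auto
  have simD: "\<exists>e\<in>elts I. elts c \<subseteq> elts d \<union> elts e \<and> elts d \<subseteq> elts c \<union> elts e" if "sim c d" for c d
    using that unfolding sim_def by (intro bexI) auto
  have sim_refl: "sim c c" if "c \<in> elts B" for c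
    using that I(2) by (intro simI) auto
  have sim_sym: "sim c d \<longleftrightarrow> sim d c" for c d
    unfolding sim_def by (simp add: cup_def Un_commute)
  have sim_trans: "sim c d" if s: "sim c b" "sim b d" and c: "c \<in> elts B" "d \<in> elts B" for b c d
  proof -
    obtain e f where ef: "e \<in> elts I" "f \<in> elts I"
      "elts c \<subseteq> elts b \<union> elts e" "elts b \<subseteq> elts c \<union> elts e"
      "elts b \<subseteq> elts d \<union> elts f" "elts d \<subseteq> elts b \<union> elts f"
      using simD[OF s(1)] simD[OF s(2)] by blast
    show ?thesis
      by (rule simI[OF I(4)[OF ef(1,2)] c]) (use ef in auto)
  qed
  define cls where "cls c = the_set {d \<in> elts B. sim c d}" for c
  have cls_dfn [dfn]: "definable_term s \<Longrightarrow> definable_term (\<lambda>e. cls (s e))" for s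
    by (rule definable_term1[of cls], unfold cls_def) (intro dfn)
  have cls: "elts (cls c) = {d \<in> elts B. sim c d}" for c
    unfolding cls_def by (intro elts_the_set is_set_Collect dfn)
  have cls_eq: "cls c = cls d \<longleftrightarrow> sim c d" if "c \<in> elts B" "d \<in> elts B" for c d
    unfolding elts_eq_iff[symmetric] cls
    using that sim_trans sim_sym sim_refl by blast
  define Q where "Q = the_set (cls ` elts B)"
  have Q: "elts Q = cls ` elts B"
    unfolding Q_def by (intro elts_the_set is_set_image dfn)
  \<comment> \<open>Operations on classes are given by all representatives at once, so that none has to be chosen.\<close>
  define lift2 where "lift2 F p q = the_set {e \<in> elts B. \<exists>c\<in>elts p. \<exists>d\<in>elts q. sim (F c d) e}" for F p q
  define cp where "cp p = lift2 (\<lambda>c d. diff X c) p p" for p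
  have lift2_cls: "lift2 F (cls c) (cls d) = cls (F c d)"
    if c: "c \<in> elts B" "d \<in> elts B" and F: "\<And>c d. c \<in> elts B \<Longrightarrow> d \<in> elts B \<Longrightarrow> F c d \<in> elts B"
      and cong: "\<And>c d c' d'. c \<in> elts B \<Longrightarrow> d \<in> elts B \<Longrightarrow> c' \<in> elts B \<Longrightarrow> d' \<in> elts B \<Longrightarrow>
        sim c c' \<Longrightarrow> sim d d' \<Longrightarrow> sim (F c d) (F c' d')" for F c d
  proof -
    have "(\<exists>c'\<in>elts (cls c). \<exists>d'\<in>elts (cls d). sim (F c' d') e) \<longleftrightarrow> sim (F c d) e" if e: "e \<in> elts B" for e
    proof
      assume "\<exists>c'\<in>elts (cls c). \<exists>d'\<in>elts (cls d). sim (F c' d') e"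
      then obtain c' d' where *: "c' \<in> elts B" "d' \<in> elts B" "sim c c'" "sim d d'" "sim (F c' d') e"
        by (auto simp: cls)
      then show "sim (F c d) e" using cong[OF c *(1-4)] sim_trans[OF _ *(5) F[OF c] e] by blast
    next
      assume "sim (F c d) e"
      then show "\<exists>c'\<in>elts (cls c). \<exists>d'\<in>elts (cls d). sim (F c' d') e"
        using c sim_refl by (auto simp: cls)
    qed
    then have "{e \<in> elts B. \<exists>c'\<in>elts (cls c). \<exists>d'\<in>elts (cls d). sim (F c' d') e} = {e \<in> elts B. sim (F c d) e}"
      by blast
    then show ?thesis unfolding lift2_def by (simp add: cls_def)
  qed
  have cong: "sim (cup c d) (cup c' d')" "sim (cap c d) (cap c' d')" "sim (diff X c) (diff X c')"
    if c: "c \<in> elts B" "d \<in> elts B" "c' \<in> elts B" "d' \<in> elts B" and s: "sim c c'" "sim d d'" for c d c' d'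
  proof -
    obtain e f where ef: "e \<in> elts I" "f \<in> elts I"
      "elts c \<subseteq> elts c' \<union> elts e" "elts c' \<subseteq> elts c \<union> elts e"
      "elts d \<subseteq> elts d' \<union> elts f" "elts d' \<subseteq> elts d \<union> elts f"
      using simD[OF s(1)] simD[OF s(2)] by blast
    show "sim (cup c d) (cup c' d')" "sim (cap c d) (cap c' d')" "sim (diff X c) (diff X c')"
      by (rule simI[OF I(4)[OF ef(1,2)]]; use ef c cl in auto)+
  qed
  have jn: "lift2 cup (cls c) (cls d) = cls (cup c d)" and mt: "lift2 cap (cls c) (cls d) = cls (cap c d)"
    if "c \<in> elts B" "d \<in> elts B" for c d
    by (intro lift2_cls that cl cong; assumption)+
  have cp: "cp (cls c) = cls (diff X c)" if "c \<in> elts B" for c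
    unfolding cp_def by (intro lift2_cls that cl cong; assumption)
  have distinct: "cls emp \<noteq> cls X"
  proof
    assume "cls emp = cls X"
    then have "sim emp X" using cls_eq cl(4) X by simp
    moreover have "cup (diff emp X) (diff X emp) = X" by (intro extensionality) simp
    ultimately show False using I(3) by (simp add: sim_def)
  qed
  obtain K where K: "elts K \<subseteq> elts Q" "cls emp \<in> elts K" "cls X \<notin> elts K"
    "\<And>x y. x \<in> elts K \<Longrightarrow> y \<in> elts K \<Longrightarrow> lift2 cup x y \<in> elts K"
    "\<And>x y. x \<in> elts K \<Longrightarrow> y \<in> elts Q \<Longrightarrow> lift2 cap x y = y \<Longrightarrow> y \<in> elts K"
    "\<And>x y. x \<in> elts Q \<Longrightarrow> y \<in> elts Q \<Longrightarrow> lift2 cap x y \<in> elts K \<Longrightarrow> x \<in> elts K \<or> y \<in> elts K"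
  proof (rule BPI_prime_ideal[of "lift2 cup" "lift2 cap" cp Q "cls emp" "cls X"])
    show "definable_term (\<lambda>e. lift2 cup (e 0) (e (Suc 0)))"
      "definable_term (\<lambda>e. lift2 cap (e 0) (e (Suc 0)))" "definable_term (\<lambda>e. cp (e 0))"
      unfolding cp_def lift2_def by (intro dfn)+
  next
    fix x y z assume x: "x \<in> elts Q"
    then obtain c where c: "c \<in> elts B" "x = cls c" by (auto simp: Q)
    have *: "cup c (diff X c) = X" "cap c (diff X c) = emp"
      using sub[OF c(1)] by (auto intro!: extensionality)
    show "cp x \<in> elts Q" "lift2 cup x (cp x) = cls X" "lift2 cap x (cp x) = cls emp"
      using c * by (simp_all add: cp jn mt cl Q)
    assume y: "y \<in> elts Q"
    then obtain d where d: "d \<in> elts B" "y = cls d" by (auto simp: Q)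
    have *: "cup c d = cup d c" "cap c d = cap d c" "cup c (cap c d) = c" "cap c (cup c d) = c"
      by (auto intro!: extensionality)
    show "lift2 cup x y \<in> elts Q" "lift2 cap x y \<in> elts Q"
      "lift2 cup x y = lift2 cup y x" "lift2 cap x y = lift2 cap y x"
      "lift2 cup x (lift2 cap x y) = x" "lift2 cap x (lift2 cup x y) = x"
      using c d * by (simp_all add: jn mt cl Q)
    assume z: "z \<in> elts Q"
    then obtain e where e: "e \<in> elts B" "z = cls e" by (auto simp: Q)
    have *: "cup c (cup d e) = cup (cup c d) e" "cap c (cap d e) = cap (cap c d) e"
      "cap c (cup d e) = cup (cap c d) (cap c e)" "cup c (cap d e) = cap (cup c d) (cup c e)"
      by (auto intro!: extensionality)
    show "lift2 cup x (lift2 cup y z) = lift2 cup (lift2 cup x y) z"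
      "lift2 cap x (lift2 cap y z) = lift2 cap (lift2 cap x y) z"
      "lift2 cap x (lift2 cup y z) = lift2 cup (lift2 cap x y) (lift2 cap x z)"
      "lift2 cup x (lift2 cap y z) = lift2 cap (lift2 cup x y) (lift2 cup x z)"
      using c d e * by (simp_all add: jn mt cl)
  qed (use assms(1) distinct X cl in \<open>auto simp: Q\<close>)
  define p where "p = the_set {c \<in> elts B. cls c \<notin> elts K}"
  have p: "elts p = {c \<in> elts B. cls c \<notin> elts K}"
    unfolding p_def by (intro elts_the_set is_set_Collect dfn)
  show ?thesis
  proof (rule that[of p])
    show "elts p \<inter> elts I = {}"
    proof (intro equals0I)
      fix c assume "c \<in> elts p \<inter> elts I"
      moreover from this have "sim c emp" using I cl by (intro simI[of c]) auto
      ultimately show False using cls_eq[of c emp] cl K by (auto simp: p)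
    qed
    show "ultrafilter X B p"
      unfolding ultrafilter_def
    proof (intro conjI ballI impI)
      show "elts p \<subseteq> elts B" "X \<in> elts p" "emp \<notin> elts p"
        using X K by (auto simp: p)
    next
      fix c d assume "c \<in> elts p" "d \<in> elts p"
      then show "cap c d \<in> elts p"
        using K(6)[of "cls c" "cls d"] cl by (auto simp: p mt Q)
    next
      fix c d assume c: "c \<in> elts p" "d \<in> elts B" "elts c \<subseteq> elts d"
      then have "cap d c = c" by (intro extensionality) auto
      then show "d \<in> elts p"
        using K(5)[of "cls d" "cls c"] c by (auto simp: p mt Q)
    next
      fix c assume c: "c \<in> elts B"
      then have "cup c (diff X c) = X" using sub by (intro extensionality) auto
      then show "c \<in> elts p \<or> diff X c \<in> elts p"
        using K(4)[of "cls c" "cls (diff X c)"] K(3) c cl by (auto simp: p jn)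
    qed
  qed
qed

section \<open>Topological spaces\<close>

text \<open>
  These two definitions speak about collections rather than elements of the model, so that the set
  operations of HOL can be used directly.
\<close>

definition open_set :: "'a \<Rightarrow> 'a set \<Rightarrow> bool" where
  "open_set T A \<longleftrightarrow> (\<exists>u\<in>elts T. elts u = A)"

definition clopen_set :: "'a \<Rightarrow> 'a \<Rightarrow> 'a set \<Rightarrow> bool" where
  "clopen_set X T A \<longleftrightarrow> A \<subseteq> elts X \<and> open_set T A \<and> open_set T (elts X - A)"

lemma open_set_elts [simp]: "open_set T (elts u) \<longleftrightarrow> u \<in> elts T"
  by (auto simp: open_set_def elts_eq_iff)

lemma open_set_is_set: "open_set T A \<Longrightarrow> is_set A"
  by (auto simp: open_set_def)

lemma clopen_in_iff: "clopen_in X T c \<longleftrightarrow> clopen_set X T (elts c)"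
  unfolding clopen_in_def closed_in_def clopen_set_def open_set_def[of T "elts X - elts c"] by auto

lemma topologyI:
  assumes "\<And>A. open_set T A \<Longrightarrow> A \<subseteq> elts X" "open_set T {}" "open_set T (elts X)"
    "\<And>S. elts S \<subseteq> elts T \<Longrightarrow> open_set T (\<Union>v\<in>elts S. elts v)"
    "\<And>A B. open_set T A \<Longrightarrow> open_set T B \<Longrightarrow> open_set T (A \<inter> B)"
  shows "topology_on X T"
  unfolding topology_on_def is_Union_def
proof (intro conjI ballI allI impI)
  show "\<exists>u\<in>elts T. elts u = {}" using assms(2) by (simp add: open_set_def)
  show "\<exists>u\<in>elts T. elts u = (\<Union>v\<in>elts S. elts v)" if "elts S \<subseteq> elts T" for S
    using assms(4)[OF that] by (simp add: open_set_def)
  show "\<exists>w\<in>elts T. elts w = elts u \<inter> elts v" if "u \<in> elts T" "v \<in> elts T" for u v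
    using assms(5)[of "elts u" "elts v"] that open_set_def[of T "elts u \<inter> elts v"] by simp
qed (use assms(1,3) in auto)

lemma continuous_iff:
  "continuous X T Y S f \<longleftrightarrow>
    maps f X Y \<and> (\<forall>A. open_set S A \<longrightarrow> open_set T {x \<in> elts X. app f x \<in> A})"
proof -
  have eq: "(\<forall>A. open_set S A \<longrightarrow> P A) \<longleftrightarrow> (\<forall>v\<in>elts S. P (elts v))" for P
    unfolding open_set_def by (metis (no_types))
  show ?thesis
    unfolding continuous_def eq unfolding open_set_def by (intro conj_cong refl) (simp add: vimage_fun)
qed

context
  fixes X T
  assumes top: "topology_on X T"
begin

lemma open_set_subset: "open_set T A \<Longrightarrow> A \<subseteq> elts X"
  using top by (auto simp: topology_on_def open_set_def)

lemma open_set_empty: "open_set T {}"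
  using top by (simp add: topology_on_def open_set_def)

lemma open_set_space: "open_set T (elts X)"
  using top by (simp add: topology_on_def)

lemma open_set_Int: "open_set T A \<Longrightarrow> open_set T B \<Longrightarrow> open_set T (A \<inter> B)"
  using top unfolding topology_on_def open_set_def by metis

lemma open_set_Union: "elts S \<subseteq> elts T \<Longrightarrow> open_set T (\<Union>v\<in>elts S. elts v)"
  using top unfolding topology_on_def open_set_def is_Union_def by metis

text \<open>
  The union of the members of the topology inside a set is formed by separation, without choosing
  neighbourhoods; only the existence of the collection as a set has to be supplied.
\<close>

lemma open_set_locally:
  assumes "is_set A" and "\<And>x. x \<in> A \<Longrightarrow> \<exists>B. open_set T B \<and> x \<in> B \<and> B \<subseteq> A"
  shows "open_set T A"
proof -
  obtain a where a: "elts a = A" using assms(1) by (auto simp: is_set_def)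
  define S where "S = the_set {v \<in> elts T. elts v \<subseteq> elts a}"
  have S: "elts S = {v \<in> elts T. elts v \<subseteq> elts a}"
    unfolding S_def by (intro elts_the_set is_set_Collect dfn)
  then have "open_set T (\<Union>v\<in>elts S. elts v)" by (intro open_set_Union) auto
  moreover have "(\<Union>v\<in>elts S. elts v) = A"
  proof
    show "(\<Union>v\<in>elts S. elts v) \<subseteq> A" using S a by auto
    show "A \<subseteq> (\<Union>v\<in>elts S. elts v)"
    proof
      fix x assume "x \<in> A"
      then obtain B where B: "open_set T B" "x \<in> B" "B \<subseteq> A" using assms(2) by blast
      then obtain u where "u \<in> elts T" "elts u = B" by (auto simp: open_set_def)
      then show "x \<in> (\<Union>v\<in>elts S. elts v)" using S B a by auto
    qed
  qed
  ultimately show ?thesis by simp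
qed

lemma open_set_Un:
  assumes "open_set T A" "open_set T B"
  shows "open_set T (A \<union> B)"
  by (rule open_set_locally) (use assms open_set_is_set in auto)

lemma clopen_set_empty: "clopen_set X T {}"
  by (simp add: clopen_set_def open_set_empty open_set_space del: open_set_elts)

lemma clopen_set_compl: "clopen_set X T A \<Longrightarrow> clopen_set X T (elts X - A)"
  by (auto simp: clopen_set_def double_diff)

lemma clopen_set_space: "clopen_set X T (elts X)"
  using clopen_set_compl[OF clopen_set_empty] by simp

lemma clopen_set_Int: "clopen_set X T A \<Longrightarrow> clopen_set X T B \<Longrightarrow> clopen_set X T (A \<inter> B)"
  using open_set_Int[of A B] open_set_Un[of "elts X - A" "elts X - B"]
  by (auto simp: clopen_set_def Diff_Int)

lemma clopen_set_Diff: "clopen_set X T A \<Longrightarrow> clopen_set X T B \<Longrightarrow> clopen_set X T (A - B)"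
proof -
  assume AB: "clopen_set X T A" "clopen_set X T B"
  then have "A - B = A \<inter> (elts X - B)" by (auto simp: clopen_set_def)
  then show ?thesis using clopen_set_Int[OF AB(1) clopen_set_compl[OF AB(2)]] by simp
qed

lemma zero_dimensional_iff:
  "zero_dimensional X T \<longleftrightarrow>
    (\<forall>A. open_set T A \<longrightarrow> (\<forall>x\<in>A. \<exists>C. clopen_set X T C \<and> x \<in> C \<and> C \<subseteq> A))"
proof
  assume zd: "zero_dimensional X T"
  show "\<forall>A. open_set T A \<longrightarrow> (\<forall>x\<in>A. \<exists>C. clopen_set X T C \<and> x \<in> C \<and> C \<subseteq> A)"
  proof (intro allI impI ballI)
    fix A x assume A: "open_set T A" "x \<in> A"
    then obtain u where u: "u \<in> elts T" "elts u = A" by (auto simp: open_set_def)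
    obtain S where S: "\<forall>c\<in>elts S. clopen_in X T c" "is_Union u S"
      using zd u by (auto simp: zero_dimensional_def)
    then obtain c where "c \<in> elts S" "x \<in> elts c" using A u by (auto simp: is_Union_def)
    then show "\<exists>C. clopen_set X T C \<and> x \<in> C \<and> C \<subseteq> A"
      using S u by (intro exI[of _ "elts c"]) (auto simp: clopen_in_iff is_Union_def)
  qed
next
  assume *: "\<forall>A. open_set T A \<longrightarrow> (\<forall>x\<in>A. \<exists>C. clopen_set X T C \<and> x \<in> C \<and> C \<subseteq> A)"
  show "zero_dimensional X T"
    unfolding zero_dimensional_def
  proof
    fix u assume u: "u \<in> elts T"
    define S where "S = the_set {c \<in> elts T. clopen_in X T c \<and> elts c \<subseteq> elts u}"
    have S: "elts S = {c \<in> elts T. clopen_in X T c \<and> elts c \<subseteq> elts u}"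
      unfolding S_def by (intro elts_the_set is_set_Collect dfn)
    have "is_Union u S"
      unfolding is_Union_def
    proof
      show "elts u \<subseteq> (\<Union>v\<in>elts S. elts v)"
      proof
        fix x assume "x \<in> elts u"
        then obtain C where C: "clopen_set X T C" "x \<in> C" "C \<subseteq> elts u"
          using *[rule_format, of "elts u" x] u by auto
        then obtain c where "c \<in> elts T" "elts c = C" by (auto simp: clopen_set_def open_set_def)
        then show "x \<in> (\<Union>v\<in>elts S. elts v)" using C by (auto simp: S clopen_in_iff)
      qed
    qed (auto simp: S)
    then show "\<exists>S. (\<forall>c\<in>elts S. clopen_in X T c) \<and> is_Union u S" using S by auto
  qed
qed

lemma clopen_separates_points:
  assumes "zero_dimensional X T" "T1_space X T" "x \<in> elts X" "y \<in> elts X" "x \<noteq> y"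
  obtains C where "clopen_set X T C" "x \<in> C" "y \<notin> C"
proof -
  obtain u where "u \<in> elts T" "x \<in> elts u" "y \<notin> elts u"
    using assms by (auto simp: T1_space_def)
  then show ?thesis
    using assms(1)[unfolded zero_dimensional_iff, rule_format, of "elts u" x] that by auto
qed

text \<open>
  Compactness as an induction principle: a definable property that passes to unions of two sets and
  holds on a neighbourhood of each point holds for the whole space. The finite
  subcover is absorbed by one induction over its members.
\<close>

lemma compact_ideal:
  assumes compact: "compact_space X T" and Q: "definable (\<lambda>e. Q (e 0))"
    and empty: "\<And>z. elts z = {} \<Longrightarrow> Q z"
    and Un: "\<And>u v w. Q u \<Longrightarrow> Q v \<Longrightarrow> elts w = elts u \<union> elts v \<Longrightarrow> Q w"
    and cover: "\<And>x. x \<in> elts X \<Longrightarrow> \<exists>u\<in>elts T. x \<in> elts u \<and> Q u"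
  shows "Q X"
proof -
  define S where "S = the_set {u \<in> elts T. Q u}"
  have S: "elts S = {u \<in> elts T. Q u}"
    unfolding S_def by (intro elts_the_set is_set_Collect Q)
  have "is_Union X S"
    unfolding is_Union_def
  proof
    show "elts X \<subseteq> (\<Union>v\<in>elts S. elts v)" using cover by (auto simp: S)
    show "(\<Union>v\<in>elts S. elts v) \<subseteq> elts X"
      unfolding S using open_set_subset[of "elts _"] by auto
  qed
  then obtain F where F: "elts F \<subseteq> elts S" "finite_set F" "is_Union X F"
    using compact S unfolding compact_space_def by blast
  from F(2) have "elts F \<subseteq> elts S \<longrightarrow> (\<exists>u. is_Union u F \<and> Q u)"
  proof (induction rule: finite_set_induct)
    case definable
    show ?case by (intro dfn definable1[OF Q])
  next
    case (empty Z)
    have "is_Union emp Z" using empty by (simp add: is_Union_def)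
    moreover have "Q emp" by (rule assms(3)) simp
    ultimately show ?case by blast
  next
    case (insert F a G)
    show ?case
    proof
      assume G: "elts G \<subseteq> elts S"
      then obtain u where u: "is_Union u F" "Q u" using insert by auto
      have "is_Union (cup a u) G" using u(1) insert by (simp add: is_Union_def)
      moreover have "Q a" using G insert S by auto
      then have "Q (cup a u)" by (rule Un[OF _ u(2)]) simp
      ultimately show "\<exists>u. is_Union u G \<and> Q u" by blast
    qed
  qed
  then obtain u where "is_Union u F" "Q u" using F(1) by blast
  moreover have "u = X"
    using \<open>is_Union u F\<close> F(3) by (intro extensionality) (simp add: is_Union_def)
  ultimately show ?thesis by simp
qed

end

lemma continuous_clopen_preimage:
  assumes "continuous X T Y S f" "clopen_set Y S A"
  shows "clopen_set X T {x \<in> elts X. app f x \<in> A}"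
proof -
  have "elts X - {x \<in> elts X. app f x \<in> A} = {x \<in> elts X. app f x \<in> elts Y - A}"
    using assms(1) app_in by (auto simp: continuous_iff)
  then show ?thesis using assms by (auto simp: clopen_set_def continuous_iff)
qed

text \<open>
  The clopen sets form a base, so it is enough to look at their preimages.
\<close>

lemma continuous_into_zero_dimensional:
  assumes "topology_on X T" "topology_on Y S" "zero_dimensional Y S" "maps f X Y"
    and "\<And>C. clopen_set Y S C \<Longrightarrow> open_set T {x \<in> elts X. app f x \<in> C}"
  shows "continuous X T Y S f"
  unfolding continuous_iff
proof (intro conjI allI impI)
  fix A assume A: "open_set S A"
  then obtain a where a: "elts a = A" by (auto simp: open_set_def)
  show "open_set T {x \<in> elts X. app f x \<in> A}"
  proof (rule open_set_locally[OF assms(1)])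
    show "is_set {x \<in> elts X. app f x \<in> A}"
      unfolding a[symmetric] by (intro is_set_Collect dfn)
    fix x assume "x \<in> {x \<in> elts X. app f x \<in> A}"
    then obtain C where "clopen_set Y S C" "app f x \<in> C" "C \<subseteq> A" "x \<in> elts X"
      using assms(3)[unfolded zero_dimensional_iff[OF assms(2)]] A by blast
    then show "\<exists>B. open_set T B \<and> x \<in> B \<and> B \<subseteq> {x \<in> elts X. app f x \<in> A}"
      using assms(5) by (intro exI[of _ "{x \<in> elts X. app f x \<in> C}"]) auto
  qed
qed (fact assms(4))

lemma graph_of_comp_eq_iff:
  assumes "maps b X Y" "maps g Y K" "maps f X K"
  shows "graph_of b O graph_of g = graph_of f \<longleftrightarrow> (\<forall>x\<in>elts X. app g (app b x) = app f x)"
proof -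
  have "(x, z) \<in> graph_of b O graph_of g \<longleftrightarrow> x \<in> elts X \<and> z = app g (app b x)" for x z
    using assms app_in by (auto simp: pair_in_fun_iff relcomp_unfold)
  moreover have "(x, z) \<in> graph_of f \<longleftrightarrow> x \<in> elts X \<and> z = app f x" for x z
    using assms(3) by (simp add: pair_in_fun_iff)
  ultimately show ?thesis by (auto simp: set_eq_iff simp del: in_graph_of_iff)
qed

section \<open>Stone spaces\<close>

lemma definable_ultrafilter [dfn]:
  "definable_term p \<Longrightarrow> definable (\<lambda>e. ultrafilter X B (p e))"
  by (rule definable1[of "ultrafilter X B"], unfold ultrafilter_def) (intro dfn)

definition stone_points :: "'a \<Rightarrow> 'a \<Rightarrow> 'a" where
  "stone_points X B = the_set {p \<in> elts (the_set {p. elts p \<subseteq> elts B}). ultrafilter X B p}"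

definition stone_basic :: "'a \<Rightarrow> 'a \<Rightarrow> 'a \<Rightarrow> 'a set" where
  "stone_basic X B c = {p \<in> elts (stone_points X B). c \<in> elts p}"

definition stone_topology :: "'a \<Rightarrow> 'a \<Rightarrow> 'a" where
  "stone_topology X B =
    the_set {u \<in> elts (the_set {u. elts u \<subseteq> elts (stone_points X B)}).
      \<forall>p\<in>elts u. \<exists>c\<in>elts p. stone_basic X B c \<subseteq> elts u}"

lemma elts_stone_points: "elts (stone_points X B) = {p. ultrafilter X B p}"
proof -
  have "elts (stone_points X B) = {p \<in> elts (the_set {p. elts p \<subseteq> elts B}). ultrafilter X B p}"
    unfolding stone_points_def by (intro elts_the_set is_set_Collect dfn)
  then show ?thesis by (auto simp: ultrafilter_def)
qed

lemma definable_stone_basic [dfn]: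
  "definable_term c \<Longrightarrow> definable_set (\<lambda>e. stone_basic X B (c e))"
  unfolding stone_basic_def by (intro dfn definable_shift)

lemma is_set_stone_basic: "is_set (stone_basic X B c)"
  unfolding stone_basic_def by (intro is_set_Collect dfn)

text \<open>
  The topology is given by neighbourhoods instead of by unions of basic sets, so that
  it is defined by a single instance of separation.
\<close>

lemma open_stone_iff:
  "open_set (stone_topology X B) A \<longleftrightarrow> is_set A \<and> A \<subseteq> elts (stone_points X B) \<and>
     (\<forall>p\<in>A. \<exists>c\<in>elts p. stone_basic X B c \<subseteq> A)"
proof -
  have *: "elts (stone_topology X B) = {u \<in> elts (the_set {u. elts u \<subseteq> elts (stone_points X B)}).
      \<forall>p\<in>elts u. \<exists>c\<in>elts p. stone_basic X B c \<subseteq> elts u}"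
    unfolding stone_topology_def by (intro elts_the_set is_set_Collect dfn)
  show ?thesis unfolding open_set_def * is_set_def by auto
qed

context
  fixes X B
  assumes B: "set_algebra X B"
begin

lemma ultrafilter_cap:
  assumes "ultrafilter X B p" "c \<in> elts B" "d \<in> elts B"
  shows "cap c d \<in> elts p \<longleftrightarrow> c \<in> elts p \<and> d \<in> elts p"
proof -
  have "cap c d \<in> elts B" using B assms by (simp add: set_algebra_def)
  then show ?thesis
    using assms unfolding ultrafilter_def by (metis elts_set_ops(2) inf_le1 inf_le2)
qed

lemma ultrafilter_compl:
  assumes "ultrafilter X B p" "c \<in> elts B"
  shows "diff X c \<in> elts p \<longleftrightarrow> c \<notin> elts p"
proof -
  have "cap c (diff X c) = emp" by (intro extensionality) auto
  then show ?thesis using assms unfolding ultrafilter_def by metis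
qed

lemma topology_stone: "topology_on (stone_points X B) (stone_topology X B)"
proof (rule topologyI)
  show "open_set (stone_topology X B) (elts (stone_points X B))"
    unfolding open_stone_iff
  proof (intro conjI is_set_elts order_refl ballI)
    fix p assume "p \<in> elts (stone_points X B)"
    then show "\<exists>c\<in>elts p. stone_basic X B c \<subseteq> elts (stone_points X B)"
      by (intro bexI[of _ X]) (auto simp: stone_basic_def elts_stone_points ultrafilter_def)
  qed
  fix S assume S: "elts S \<subseteq> elts (stone_topology X B)"
  have v: "elts v \<subseteq> elts (stone_points X B)"
    "\<And>p. p \<in> elts v \<Longrightarrow> \<exists>c\<in>elts p. stone_basic X B c \<subseteq> elts v" if "v \<in> elts S" for v
    using S that open_stone_iff[of X B "elts v"] by auto
  show "open_set (stone_topology X B) (\<Union>v\<in>elts S. elts v)"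
    unfolding open_stone_iff
  proof (intro conjI is_set_UN ballI)
    show "(\<Union>v\<in>elts S. elts v) \<subseteq> elts (stone_points X B)" using v(1) by (rule UN_least)
    fix p assume "p \<in> (\<Union>v\<in>elts S. elts v)"
    then obtain w where w: "w \<in> elts S" "p \<in> elts w" by (rule UN_E)
    then obtain c where "c \<in> elts p" "stone_basic X B c \<subseteq> elts w" using v(2)[OF w] by (elim bexE)
    then show "\<exists>c\<in>elts p. stone_basic X B c \<subseteq> (\<Union>v\<in>elts S. elts v)"
      using w(1) by (intro bexI[of _ c]) auto
  qed
next
  fix U V assume UV: "open_set (stone_topology X B) U" "open_set (stone_topology X B) V"
  show "open_set (stone_topology X B) (U \<inter> V)"
    unfolding open_stone_iff
  proof (intro conjI ballI)
    fix p assume p: "p \<in> U \<inter> V"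
    then obtain c d where cd: "c \<in> elts p" "stone_basic X B c \<subseteq> U" "d \<in> elts p" "stone_basic X B d \<subseteq> V"
      using UV unfolding open_stone_iff by blast
    have p: "ultrafilter X B p"
      using p UV unfolding open_stone_iff elts_stone_points by auto
    have B': "c \<in> elts B" "d \<in> elts B" using p cd by (auto simp: ultrafilter_def)
    have "stone_basic X B (cap c d) \<subseteq> U \<inter> V"
      using cd ultrafilter_cap[OF _ B'] by (auto simp: stone_basic_def elts_stone_points)
    then show "\<exists>c\<in>elts p. stone_basic X B c \<subseteq> U \<inter> V"
      using ultrafilter_cap[OF p B'] cd by blast
  qed (use UV open_stone_iff in auto)
qed (simp_all add: open_stone_iff)

lemma clopen_stone_basic:
  assumes "c \<in> elts B"
  shows "clopen_set (stone_points X B) (stone_topology X B) (stone_basic X B c)"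
proof -
  have *: "open_set (stone_topology X B) (stone_basic X B c)" for c
    unfolding open_stone_iff using is_set_stone_basic by (auto simp: stone_basic_def)
  have "elts (stone_points X B) - stone_basic X B c = stone_basic X B (diff X c)"
    using ultrafilter_compl[OF _ assms] by (auto simp: stone_basic_def elts_stone_points)
  then show ?thesis using * by (auto simp: clopen_set_def stone_basic_def)
qed

lemma zero_dimensional_stone: "zero_dimensional (stone_points X B) (stone_topology X B)"
  unfolding zero_dimensional_iff[OF topology_stone]
proof (intro allI impI ballI)
  fix A p assume A: "open_set (stone_topology X B) A" "p \<in> A"
  then obtain c where c: "c \<in> elts p" "stone_basic X B c \<subseteq> A" "p \<in> elts (stone_points X B)"
    unfolding open_stone_iff by blast
  then have "c \<in> elts B" by (auto simp: elts_stone_points ultrafilter_def)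
  then show "\<exists>C. clopen_set (stone_points X B) (stone_topology X B) C \<and> p \<in> C \<and> C \<subseteq> A"
    using c clopen_stone_basic by (intro exI[of _ "stone_basic X B c"]) (auto simp: stone_basic_def)
qed

lemma T1_stone: "T1_space (stone_points X B) (stone_topology X B)"
  unfolding T1_space_def
proof (intro ballI impI)
  fix p q assume pq: "p \<in> elts (stone_points X B)" "q \<in> elts (stone_points X B)" "p \<noteq> q"
  have "\<exists>c. c \<in> elts p \<and> c \<notin> elts q"
  proof (rule ccontr)
    assume "\<nexists>c. c \<in> elts p \<and> c \<notin> elts q"
    then have sub: "elts p \<subseteq> elts q" by blast
    have "elts q \<subseteq> elts p"
    proof
      fix c assume c: "c \<in> elts q"
      then have "c \<in> elts B" using pq by (auto simp: elts_stone_points ultrafilter_def)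
      then show "c \<in> elts p"
        using ultrafilter_compl[of p c] ultrafilter_compl[of q c] pq c sub by (auto simp: elts_stone_points)
    qed
    then show False using sub pq(3) extensionality by blast
  qed
  then obtain c where c: "c \<in> elts p" "c \<notin> elts q" by blast
  then have "c \<in> elts B" using pq by (auto simp: elts_stone_points ultrafilter_def)
  then have "open_set (stone_topology X B) (stone_basic X B c)"
    using clopen_stone_basic by (simp add: clopen_set_def)
  then show "\<exists>u\<in>elts (stone_topology X B). p \<in> elts u \<and> q \<notin> elts u"
    unfolding open_set_def using c pq(1) by (auto simp: stone_basic_def)
qed

text \<open>
  The basic sets that are covered by finitely many members of a cover without finite subcover come from a proper
  ideal of the algebra. An ultrafilter that avoids it is a point covered by some member of the cover,
  which by itself covers a basic neighbourhood of that point.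
\<close>

lemma compact_stone:
  assumes BPI
  shows "compact_space (stone_points X B) (stone_topology X B)"
  unfolding compact_space_def
proof (intro allI impI, elim conjE, rule ccontr)
  fix S assume S: "elts S \<subseteq> elts (stone_topology X B)" and cover: "is_Union (stone_points X B) S"
    and no: "\<nexists>F. elts F \<subseteq> elts S \<and> finite_set F \<and> is_Union (stone_points X B) F"
  define covered where "covered c \<longleftrightarrow>
    (\<exists>F. elts F \<subseteq> elts S \<and> finite_set F \<and> (\<forall>q\<in>stone_basic X B c. \<exists>u\<in>elts F. q \<in> elts u))" for c
  define I where "I = the_set {c \<in> elts B. covered c}"
  have I: "elts I = {c \<in> elts B. covered c}"
    unfolding I_def by (intro elts_the_set is_set_Collect) (unfold covered_def, intro dfn)
  have X: "X \<in> elts B" using B by (simp add: set_algebra_def)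
  obtain p where p: "ultrafilter X B p" "elts p \<inter> elts I = {}"
  proof (rule ultrafilter_avoiding_ideal[OF assms B, of I])
    show "elts I \<subseteq> elts B" by (auto simp: I)
    have "covered emp"
      unfolding covered_def stone_basic_def
      by (intro exI[of _ emp] conjI finite_set_empty)
        (auto simp: elts_stone_points ultrafilter_def)
    then show "emp \<in> elts I" using set_algebra_empty[OF B] by (simp add: I)
    show "X \<notin> elts I"
    proof
      assume "X \<in> elts I"
      then obtain F where F: "elts F \<subseteq> elts S" "finite_set F"
        "\<forall>q\<in>stone_basic X B X. \<exists>u\<in>elts F. q \<in> elts u" by (auto simp: I covered_def)
      have "is_Union (stone_points X B) F"
        unfolding is_Union_def
      proof
        show "elts (stone_points X B) \<subseteq> (\<Union>v\<in>elts F. elts v)"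
          using F(3) by (auto simp: stone_basic_def elts_stone_points ultrafilter_def)
        show "(\<Union>v\<in>elts F. elts v) \<subseteq> elts (stone_points X B)"
          using F(1) cover by (auto simp: is_Union_def)
      qed
      then show False using no F by blast
    qed
    show "cup c d \<in> elts I" if "c \<in> elts I" "d \<in> elts I" for c d
    proof -
      from that have cd: "c \<in> elts B" "d \<in> elts B" by (auto simp: I)
      from that obtain F G where F: "elts F \<subseteq> elts S" "finite_set F"
          "\<forall>q\<in>stone_basic X B c. \<exists>u\<in>elts F. q \<in> elts u"
        and G: "elts G \<subseteq> elts S" "finite_set G"
          "\<forall>q\<in>stone_basic X B d. \<exists>u\<in>elts G. q \<in> elts u"
        unfolding I covered_def by blast
      have "cup c d = diff X (cap (diff X c) (diff X d))"
        using B cd by (intro cup_eq_de_Morgan) (auto simp: set_algebra_def)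
      then have "stone_basic X B (cup c d) \<subseteq> stone_basic X B c \<union> stone_basic X B d"
        using B cd ultrafilter_compl ultrafilter_cap
        by (auto simp: stone_basic_def elts_stone_points set_algebra_def)
      then have "\<forall>q\<in>stone_basic X B (cup c d). \<exists>u\<in>elts (cup F G). q \<in> elts u"
        unfolding elts_set_ops bex_Un using F(3) G(3) by (meson UnE subsetD)
      moreover have "finite_set (cup F G)" by (rule finite_set_Un[OF F(2) G(2)]) simp
      ultimately have "covered (cup c d)"
        unfolding covered_def using F(1) G(1) by (intro exI[of _ "cup F G"]) simp
      then show ?thesis using set_algebra_cup[OF B cd] by (simp add: I)
    qed
    show "d \<in> elts I" if "c \<in> elts I" "d \<in> elts B" "elts d \<subseteq> elts c" for c d
    proof -
      have "stone_basic X B d \<subseteq> stone_basic X B c"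
        using that by (auto simp: stone_basic_def elts_stone_points ultrafilter_def I)
      then have "covered d" using that(1) unfolding I covered_def by blast
      then show ?thesis using that(2) by (simp add: I)
    qed
  qed
  then have "p \<in> elts (stone_points X B)" by (simp add: elts_stone_points)
  then obtain u where u: "u \<in> elts S" "p \<in> elts u" using cover by (auto simp: is_Union_def)
  then have "open_set (stone_topology X B) (elts u)" using S by auto
  then obtain c where c: "c \<in> elts p" "stone_basic X B c \<subseteq> elts u"
    using u(2) unfolding open_stone_iff by blast
  have "covered c"
    unfolding covered_def
    by (rule exI[of _ "the_set {u}"]) (use u c finite_set_doubleton[of "the_set {u}" u u] in auto)
  moreover have "c \<in> elts B" using c p(1) by (auto simp: ultrafilter_def)
  ultimately show False using p(2) c(1) by (auto simp: I)
qed

end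

section \<open>The Banaschewski compactification as a Stone space\<close>

context
  fixes X T
  assumes top: "topology_on X T" and zd: "zero_dimensional X T" and T1: "T1_space X T"
begin

definition clopens :: 'a where
  "clopens = the_set {c \<in> elts T. clopen_in X T c}"

definition trace :: "'a \<Rightarrow> 'a" where
  "trace x = the_set {c \<in> elts clopens. x \<in> elts c}"

lemma elts_clopens: "elts clopens = {c. clopen_set X T (elts c)}"
proof -
  have "elts clopens = {c \<in> elts T. clopen_in X T c}"
    unfolding clopens_def by (intro elts_the_set is_set_Collect dfn)
  then show ?thesis by (auto simp: clopen_in_iff clopen_set_def)
qed

lemma elts_trace: "elts (trace x) = {c. clopen_set X T (elts c) \<and> x \<in> elts c}"
proof -
  have "elts (trace x) = {c \<in> elts clopens. x \<in> elts c}"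
    unfolding trace_def by (intro elts_the_set is_set_Collect dfn)
  then show ?thesis by (auto simp: elts_clopens)
qed

lemma set_algebra_clopens: "set_algebra X clopens"
proof -
  have "clopen_set X T A \<Longrightarrow> A \<subseteq> elts X" for A by (simp add: clopen_set_def)
  then show ?thesis
    unfolding set_algebra_def elts_clopens mem_Collect_eq elts_set_ops
    using clopen_set_space[OF top] clopen_set_compl[OF top] clopen_set_Int[OF top] by blast
qed

lemma ultrafilter_trace: "x \<in> elts X \<Longrightarrow> ultrafilter X clopens (trace x)"
  using set_algebra_clopens unfolding ultrafilter_def set_algebra_def
  by (auto simp: elts_trace elts_clopens)

lemma definable_trace [dfn]: "definable_term s \<Longrightarrow> definable_term (\<lambda>e. trace (s e))"
  by (rule definable_term1[of trace], unfold trace_def) (intro dfn)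

text \<open>
  The points of \<open>X\<close> are dense in the Stone space because every ultrafilter consists of nonempty
  clopen sets, and they are embedded because the clopen sets form a base and separate points.
  The extension of \<open>f\<close> at \<open>p\<close> is the limit of the image of \<open>p\<close> on \<open>K\<close>: it exists since
  \<open>K\<close> is compact and is unique since clopen sets separate the points of \<open>K\<close>.
\<close>

lemma banaschewski_stone:
  assumes BPI
  shows "banaschewski_compactification X T (stone_points X clopens) (stone_topology X clopens)
    (mkfun X trace)"
proof -
  let ?Y = "stone_points X clopens" and ?S = "stone_topology X clopens"
  let ?basic = "stone_basic X clopens"
  note alg = set_algebra_clopens
  have d: "definable_term (\<lambda>e. trace (e 0))" by (intro dfn)
  have b: "maps (mkfun X trace) X ?Y"
    using ultrafilter_trace by (intro maps_mkfun[OF d]) (simp add: elts_stone_points)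
  have app_b: "app (mkfun X trace) x = trace x" if "x \<in> elts X" for x
    using app_mkfun[OF d that] .
  have im_b: "graph_of (mkfun X trace) `` A = trace ` A" if "A \<subseteq> elts X" for A
    unfolding Image_fun[OF b that] using app_b that by (intro image_cong) auto
  have basic_trace: "trace x \<in> ?basic c \<longleftrightarrow> x \<in> elts c" if "x \<in> elts X" "c \<in> elts clopens" for x c
    using that ultrafilter_trace[OF that(1)]
    by (auto simp: stone_basic_def elts_stone_points elts_trace elts_clopens)
  have cont: "continuous X T ?Y ?S (mkfun X trace)"
    unfolding continuous_iff
  proof (intro conjI b allI impI)
    fix A assume A: "open_set ?S A"
    then obtain a where a: "elts a = A" by (auto simp: open_set_def)
    show "open_set T {x \<in> elts X. app (mkfun X trace) x \<in> A}"
    proof (rule open_set_locally[OF top])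
      show "is_set {x \<in> elts X. app (mkfun X trace) x \<in> A}"
        unfolding a[symmetric] by (intro is_set_Collect dfn)
      fix x assume x: "x \<in> {x \<in> elts X. app (mkfun X trace) x \<in> A}"
      then obtain c where c: "c \<in> elts (trace x)" "?basic c \<subseteq> A"
        using A unfolding open_stone_iff by (auto simp: app_b)
      have "elts c \<subseteq> {x \<in> elts X. app (mkfun X trace) x \<in> A}"
      proof
        have cc: "c \<in> elts clopens" "elts c \<subseteq> elts X"
          using c by (auto simp: elts_trace elts_clopens clopen_set_def)
        fix y assume y: "y \<in> elts c"
        then have "y \<in> elts X" using cc(2) by blast
        moreover from this have "trace y \<in> A" using c(2) basic_trace[OF _ cc(1)] y by blast
        ultimately show "y \<in> {x \<in> elts X. app (mkfun X trace) x \<in> A}" by (simp add: app_b)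
      qed
      then show "\<exists>B. open_set T B \<and> x \<in> B \<and> B \<subseteq> {x \<in> elts X. app (mkfun X trace) x \<in> A}"
        using c by (intro exI[of _ "elts c"]) (auto simp: elts_trace clopen_set_def)
    qed
  qed
  have inj: "injective (mkfun X trace)"
    unfolding injective_iff[OF b]
  proof (rule inj_onI, rule ccontr)
    fix x y assume xy: "x \<in> elts X" "y \<in> elts X" "app (mkfun X trace) x = app (mkfun X trace) y" "x \<noteq> y"
    then obtain C where C: "clopen_set X T C" "x \<in> C" "y \<notin> C"
      using clopen_separates_points[OF top zd T1] by metis
    then obtain c where "elts c = C" by (auto simp: clopen_set_def open_set_def)
    then have "c \<in> elts (trace x)" "c \<notin> elts (trace y)" using C by (auto simp: elts_trace)
    then show False using xy by (simp add: app_b)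
  qed
  have emb: "\<exists>v\<in>elts ?S. graph_of (mkfun X trace) `` elts u =
      elts v \<inter> graph_of (mkfun X trace) `` elts X" if u: "u \<in> elts T" for u
  proof -
    have uX: "elts u \<subseteq> elts X" using open_set_subset[OF top, of "elts u"] u by simp
    define V where "V = {p \<in> elts ?Y. \<exists>c\<in>elts p. elts c \<subseteq> elts u}"
    have "is_set V" unfolding V_def by (intro is_set_Collect dfn)
    then have "open_set ?S V"
      unfolding open_stone_iff by (auto simp: V_def stone_basic_def)
    then obtain v where v: "v \<in> elts ?S" "elts v = V" by (auto simp: open_set_def)
    have "trace x \<in> V \<longleftrightarrow> x \<in> elts u" if x: "x \<in> elts X" for x
    proof
      assume "trace x \<in> V"
      then show "x \<in> elts u" by (auto simp: V_def elts_trace)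
    next
      assume "x \<in> elts u"
      then obtain C where C: "clopen_set X T C" "x \<in> C" "C \<subseteq> elts u"
        using zd[unfolded zero_dimensional_iff[OF top], rule_format, of "elts u" x] u by auto
      then obtain c where "elts c = C" by (auto simp: clopen_set_def open_set_def)
      then show "trace x \<in> V"
        using C ultrafilter_trace[OF x] by (auto simp: V_def elts_trace elts_stone_points)
    qed
    then have "trace ` elts u = V \<inter> trace ` elts X" using uX by auto
    then show ?thesis using v im_b[OF uX] im_b[OF order_refl] by auto
  qed
  have dense: "elts v \<inter> graph_of (mkfun X trace) `` elts X \<noteq> {}"
    if v: "v \<in> elts ?S" and ne: "elts v \<noteq> {}" for v
  proof -
    have "open_set ?S (elts v)" using v by simp
    moreover obtain p where p: "p \<in> elts v" using ne by blast
    ultimately obtain c where c: "c \<in> elts p" "?basic c \<subseteq> elts v" "ultrafilter X clopens p"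
      unfolding open_stone_iff elts_stone_points by blast
    then have cc: "c \<in> elts clopens" "c \<noteq> emp" by (auto simp: ultrafilter_def)
    then have "elts c \<noteq> {}" using extensionality[of c emp] by auto
    then obtain x where x: "x \<in> elts c" by blast
    then have xX: "x \<in> elts X" using cc by (auto simp: elts_clopens clopen_set_def)
    then have "trace x \<in> elts v" using basic_trace[OF xX cc(1)] x c(2) by blast
    then show ?thesis using xX unfolding im_b[OF order_refl] by blast
  qed
  have comp: "compactification X T ?Y ?S (mkfun X trace)"
    unfolding compactification_def embedding_def
    using topology_stone[OF alg] compact_stone[OF alg assms] cont inj emb dense by blast
  have ext: "\<exists>g. continuous ?Y ?S K R g \<and> graph_of (mkfun X trace) O graph_of g = graph_of f"
    if K: "topology_on K R" "compact_space K R" "zero_dimensional K R" "T1_space K R"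
      and f: "continuous X T K R f" for K R f
  proof -
    have mf: "maps f X K" using f by (simp add: continuous_iff)
    define pre where "pre C = the_set {x \<in> elts X. app f x \<in> elts C}" for C
    have pre: "elts (pre C) = {x \<in> elts X. app f x \<in> elts C}" for C
      unfolding pre_def by (intro elts_the_set is_set_Collect dfn)
    have pre_dfn [dfn]: "definable_term s \<Longrightarrow> definable_term (\<lambda>e. pre (s e))" for s
      by (rule definable_term1[of pre], unfold pre_def) (intro dfn)
    have pre_clopen: "pre C \<in> elts clopens" if "clopen_set K R (elts C)" for C
      using continuous_clopen_preimage[OF f that] by (simp add: elts_clopens pre)
    \<comment> \<open>\<open>lim p y\<close>: the image under \<open>f\<close> of the ultrafilter \<open>p\<close> converges to \<open>y\<close>.\<close>
    define lim where "lim p y \<longleftrightarrow> y \<in> elts K \<and> (\<forall>C\<in>elts R. clopen_in K R C \<longrightarrow> y \<in> elts C \<longrightarrow> pre C \<in> elts p)" for p y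
    have lim_ex: "\<exists>y. lim p y" if p: "ultrafilter X clopens p" for p
    proof (rule ccontr)
      assume no: "\<nexists>y. lim p y"
      have "clopen_in K R K \<and> pre K \<notin> elts p"
      proof (rule compact_ideal[OF K(1,2), of "\<lambda>C. clopen_in K R C \<and> pre C \<notin> elts p"])
        show "definable (\<lambda>e. clopen_in K R (e 0) \<and> pre (e 0) \<notin> elts p)" by (intro dfn)
      next
        fix z assume "elts z = {}"
        moreover from this have "pre z = emp" by (intro extensionality) (simp add: pre)
        ultimately show "clopen_in K R z \<and> pre z \<notin> elts p"
          using p clopen_set_empty[OF K(1)] by (simp add: clopen_in_iff ultrafilter_def)
      next
        fix u v w assume uv: "clopen_in K R u \<and> pre u \<notin> elts p" "clopen_in K R v \<and> pre v \<notin> elts p"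
          and w: "elts w = elts u \<union> elts v"
        have cl: "pre u \<in> elts clopens" "pre v \<in> elts clopens"
          using uv pre_clopen by (auto simp: clopen_in_iff)
        have "elts w = elts K - ((elts K - elts u) - elts v)"
          using uv by (auto simp: w clopen_in_iff clopen_set_def)
        then have wc: "clopen_set K R (elts w)"
          using uv clopen_set_Diff[OF K(1)] clopen_set_compl[OF K(1)] by (simp add: clopen_in_iff)
        have "diff X (pre w) = cap (diff X (pre u)) (diff X (pre v))"
          by (intro extensionality) (auto simp: pre w)
        moreover have "diff X (pre u) \<in> elts p" "diff X (pre v) \<in> elts p"
          using ultrafilter_compl[OF alg p] cl uv by auto
        ultimately have "diff X (pre w) \<in> elts p"
          using p by (simp add: ultrafilter_def)
        then show "clopen_in K R w \<and> pre w \<notin> elts p"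
          using ultrafilter_compl[OF alg p pre_clopen[OF wc]] wc by (simp add: clopen_in_iff)
      next
        fix y assume "y \<in> elts K"
        then show "\<exists>u\<in>elts R. y \<in> elts u \<and> clopen_in K R u \<and> pre u \<notin> elts p"
          using no by (auto simp: lim_def)
      qed
      moreover have "pre K = X" using app_in[OF mf] by (intro extensionality) (auto simp: pre)
      ultimately show False using p by (simp add: ultrafilter_def)
    qed
    have lim_unique: "y = z" if p: "ultrafilter X clopens p" and y: "lim p y" and z: "lim p z" for p y z
    proof (rule ccontr)
      assume "y \<noteq> z"
      then obtain C where C: "clopen_set K R C" "y \<in> C" "z \<notin> C"
        using clopen_separates_points[OF K(1,3,4)] y z unfolding lim_def by metis
      then obtain c where c: "c \<in> elts R" "elts c = C" by (auto simp: clopen_set_def open_set_def)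
      have C': "clopen_set K R (elts K - C)" using clopen_set_compl[OF K(1) C(1)] .
      then obtain c' where c': "c' \<in> elts R" "elts c' = elts K - C"
        by (auto simp: clopen_set_def open_set_def)
      have "pre c \<in> elts p" using y c C by (simp add: lim_def clopen_in_iff)
      moreover have "pre c' \<in> elts p" using z c' C C' by (simp add: lim_def clopen_in_iff)
      moreover have "cap (pre c) (pre c') = emp"
        by (intro extensionality) (auto simp: pre c c')
      ultimately show False using p unfolding ultrafilter_def by metis
    qed
    \<comment> \<open>The limit, written as a union over all limits, which is visibly a definable term.\<close>
    define G where "G p = the_set {z. \<exists>y. lim p y \<and> z \<in> elts y}" for p
    have G: "G p = y" if "ultrafilter X clopens p" "lim p y" for p y
    proof -
      have "{z. \<exists>y. lim p y \<and> z \<in> elts y} = elts y"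
        using lim_unique[OF that(1)] that(2) by blast
      then show ?thesis by (simp add: G_def)
    qed
    have G_lim: "lim p (G p)" if "ultrafilter X clopens p" for p
      using lim_ex[OF that] G[OF that] by auto
    have dG: "definable_term (\<lambda>e. G (e 0))"
      unfolding G_def lim_def by (intro dfn)
    define g where "g = mkfun ?Y G"
    have g: "maps g ?Y K"
      unfolding g_def using G_lim by (intro maps_mkfun[OF dG]) (simp add: elts_stone_points lim_def)
    have app_g: "app g p = G p" if "ultrafilter X clopens p" for p
      unfolding g_def by (rule app_mkfun[OF dG]) (simp add: elts_stone_points that)
    have "continuous ?Y ?S K R g"
    proof (rule continuous_into_zero_dimensional[OF topology_stone[OF alg] K(1,3) g])
      fix C assume C: "clopen_set K R C"
      then obtain c where c: "c \<in> elts R" "elts c = C" by (auto simp: clopen_set_def open_set_def)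
      have C': "clopen_set K R (elts K - C)" using clopen_set_compl[OF K(1) C] .
      then obtain c' where c': "c' \<in> elts R" "elts c' = elts K - C"
        by (auto simp: clopen_set_def open_set_def)
      have pre_c: "pre c \<in> elts clopens" using pre_clopen C c by simp
      have pre_c': "pre c' = diff X (pre c)"
        using app_in[OF mf] by (intro extensionality) (auto simp: pre c c')
      have "G p \<in> C \<longleftrightarrow> pre c \<in> elts p" if p: "ultrafilter X clopens p" for p
      proof
        assume "G p \<in> C"
        then show "pre c \<in> elts p" using G_lim[OF p] C c by (simp add: lim_def clopen_in_iff)
      next
        assume "pre c \<in> elts p"
        then have "pre c' \<notin> elts p" using ultrafilter_compl[OF alg p pre_c] pre_c' by simp
        then show "G p \<in> C" using G_lim[OF p] C' c' by (auto simp: lim_def clopen_in_iff)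
      qed
      then have "{p \<in> elts ?Y. app g p \<in> C} = ?basic (pre c)"
        by (auto simp: stone_basic_def elts_stone_points app_g)
      then show "open_set ?S {p \<in> elts ?Y. app g p \<in> C}"
        using clopen_stone_basic[OF alg pre_c] by (simp add: clopen_set_def)
    qed
    moreover have "app g (app (mkfun X trace) x) = app f x" if x: "x \<in> elts X" for x
    proof -
      have "lim (trace x) (app f x)"
        unfolding lim_def using x app_in[OF mf x] pre_clopen
        by (auto simp: clopen_in_iff elts_trace pre elts_clopens)
      then show ?thesis using x G ultrafilter_trace app_g by (simp add: app_b)
    qed
    ultimately show ?thesis
      using graph_of_comp_eq_iff[OF b g mf] by blast
  qed
  show ?thesis
    unfolding banaschewski_compactification_def
    using comp zero_dimensional_stone[OF alg] T1_stone[OF alg] ext by blast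
qed

end

section \<open>Discrete spaces and powers\<close>

context
  fixes X T
  assumes T: "discrete_topology X T"
begin

lemma open_discrete_iff: "open_set T A \<longleftrightarrow> is_set A \<and> A \<subseteq> elts X"
  using T by (auto simp: discrete_topology_def open_set_def is_set_def)

lemma topology_discrete: "topology_on X T"
  by (rule topologyI) (use T in \<open>auto simp: open_discrete_iff is_set_UN discrete_topology_def simp del: open_set_elts\<close>)

lemma clopen_discrete_iff: "clopen_set X T A \<longleftrightarrow> is_set A \<and> A \<subseteq> elts X"
  by (auto simp: clopen_set_def open_discrete_iff)

lemma zero_dimensional_discrete: "zero_dimensional X T"
  unfolding zero_dimensional_iff[OF topology_discrete] clopen_discrete_iff open_discrete_iff by auto

lemma T1_discrete: "T1_space X T"
  unfolding T1_space_def
proof (intro ballI impI)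
  fix x y assume "x \<in> elts X" "y \<in> elts X" "x \<noteq> y"
  then show "\<exists>u\<in>elts T. x \<in> elts u \<and> y \<notin> elts u"
    using T by (intro bexI[of _ "the_set {x}"]) (auto simp: discrete_topology_def)
qed

end

definition zero :: 'a where "zero = the_set {}"
definition one :: 'a where "one = the_set {zero}"
definition two :: 'a where "two = the_set {zero, one}"
definition two_topology :: 'a where "two_topology = the_set {u. elts u \<subseteq> elts two}"

lemma elts_two: "elts two = {zero, one}"
  by (simp add: two_def)

lemma zero_neq_one: "zero \<noteq> one"
  using elts_the_set[of "{}"] elts_the_set[of "{zero}"] unfolding one_def zero_def[symmetric] by force

lemma is_two_two: "is_two two"
  unfolding is_two_def by (intro exI[of _ zero] exI[of _ one]) (simp add: elts_two zero_def one_def)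

lemma discrete_two: "discrete_topology two two_topology"
  by (simp add: discrete_topology_def two_topology_def)

lemma compact_two: "compact_space two two_topology"
  unfolding compact_space_def
proof (intro allI impI, elim conjE)
  fix S assume S: "elts S \<subseteq> elts two_topology" "is_Union two S"
  then have "zero \<in> (\<Union>v\<in>elts S. elts v)" "one \<in> (\<Union>v\<in>elts S. elts v)"
    using elts_two unfolding is_Union_def by (metis insertI1 insert_commute)+
  then obtain u v where uv: "u \<in> elts S" "zero \<in> elts u" "v \<in> elts S" "one \<in> elts v"
    by blast
  have "elts u \<subseteq> elts two" "elts v \<subseteq> elts two"
    using uv S(1) discrete_two by (auto simp: discrete_topology_def)
  then have "is_Union two (the_set {u, v})"
    using uv unfolding is_Union_def by (auto simp: elts_two)
  then show "\<exists>F. elts F \<subseteq> elts S \<and> finite_set F \<and> is_Union two F"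
    using uv finite_set_doubleton[of "the_set {u, v}" u v] by (intro exI[of _ "the_set {u, v}"]) auto
qed

lemma projections_continuous_iff:
  assumes "elts C = {f. maps f J Y}"
  shows "projections_continuous J S C T \<longleftrightarrow>
    (\<forall>j\<in>elts J. \<forall>A. open_set S A \<longrightarrow> open_set T {f \<in> elts C. app f j \<in> A})"
proof -
  have eq: "(\<forall>A. open_set S A \<longrightarrow> P A) \<longleftrightarrow> (\<forall>v\<in>elts S. P (elts v))" for P
    unfolding open_set_def by (metis (no_types))
  have "{f \<in> elts C. \<exists>y\<in>A. (j, y) \<in> graph_of f} = {f \<in> elts C. app f j \<in> A}"
    if "j \<in> elts J" for j A
    using that by (auto simp: assms pair_in_fun_iff)
  then show ?thesis
    unfolding projections_continuous_def eq unfolding open_set_def by simp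
qed

lemma power_space_clopen:
  assumes C: "power_space J Y S C T" and j: "j \<in> elts J" and A: "clopen_set Y S A"
  shows "clopen_set C T {f \<in> elts C. app f j \<in> A}"
proof -
  have e: "elts C = {f. maps f J Y}" and p: "projections_continuous J S C T"
    using C by (auto simp: power_space_def)
  have compl: "elts C - {f \<in> elts C. app f j \<in> A} = {f \<in> elts C. app f j \<in> elts Y - A}"
    using app_in[OF _ j] by (auto simp: e)
  have "open_set T {f \<in> elts C. app f j \<in> V}" if "open_set S V" for V
    using p[unfolded projections_continuous_iff[OF e]] j that by blast
  then show ?thesis
    using A unfolding clopen_set_def compl by blast
qed

text \<open>
  The topology of the power is known only as the least one that makes the projections continuous.
  Its members that are unions of clopen sets again form such a topology, so these are all of them.
\<close>

lemma zero_dimensional_power_space: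
  assumes C: "power_space J Y S C T" and Y: "topology_on Y S" "zero_dimensional Y S"
  shows "zero_dimensional C T"
proof -
  have e: "elts C = {f. maps f J Y}" and top: "topology_on C T"
    and p: "projections_continuous J S C T"
    and least: "\<And>T'. topology_on C T' \<Longrightarrow> projections_continuous J S C T' \<Longrightarrow> elts T \<subseteq> elts T'"
    using C by (auto simp: power_space_def)
  define T' where "T' = the_set {u \<in> elts T. \<forall>x\<in>elts u. \<exists>c. clopen_in C T c \<and> x \<in> elts c \<and> elts c \<subseteq> elts u}"
  have T': "elts T' = {u \<in> elts T. \<forall>x\<in>elts u. \<exists>c. clopen_in C T c \<and> x \<in> elts c \<and> elts c \<subseteq> elts u}"
    unfolding T'_def by (intro elts_the_set is_set_Collect dfn)
  have ex: "(\<exists>c. clopen_in C T c \<and> x \<in> elts c \<and> elts c \<subseteq> U) \<longleftrightarrow>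
      (\<exists>D. clopen_set C T D \<and> x \<in> D \<and> D \<subseteq> U)" for x U
    unfolding clopen_in_iff clopen_set_def by (metis open_set_def)
  have open': "open_set T' A \<longleftrightarrow> open_set T A \<and> (\<forall>x\<in>A. \<exists>D. clopen_set C T D \<and> x \<in> D \<and> D \<subseteq> A)" for A
    unfolding open_set_def T' ex by auto
  have "topology_on C T'"
  proof (rule topologyI)
    show "open_set T' (elts C)"
      unfolding open' using open_set_space[OF top] clopen_set_space[OF top] by blast
    fix S assume S: "elts S \<subseteq> elts T'"
    then have "elts S \<subseteq> elts T" by (auto simp: T')
    then show "open_set T' (\<Union>v\<in>elts S. elts v)"
      unfolding open'
    proof (intro conjI open_set_Union[OF top] ballI)
      fix x assume "x \<in> (\<Union>v\<in>elts S. elts v)"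
      then obtain v where v: "v \<in> elts S" "x \<in> elts v" by blast
      then have "open_set T' (elts v)" using S by auto
      then obtain D where "clopen_set C T D" "x \<in> D" "D \<subseteq> elts v"
        using v(2) unfolding open' by blast
      then show "\<exists>D. clopen_set C T D \<and> x \<in> D \<and> D \<subseteq> (\<Union>v\<in>elts S. elts v)"
        using v(1) by (intro exI[of _ D]) auto
    qed
  next
    fix A B assume AB: "open_set T' A" "open_set T' B"
    show "open_set T' (A \<inter> B)"
      unfolding open'
    proof (intro conjI ballI)
      show "open_set T (A \<inter> B)" using AB open_set_Int[OF top] by (simp add: open')
      fix x assume "x \<in> A \<inter> B"
      then obtain D E where DE: "clopen_set C T D" "x \<in> D" "D \<subseteq> A" "clopen_set C T E" "x \<in> E" "E \<subseteq> B"
        using AB unfolding open' by blast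
      then show "\<exists>D. clopen_set C T D \<and> x \<in> D \<and> D \<subseteq> A \<inter> B"
        using clopen_set_Int[OF top DE(1,4)] by (intro exI[of _ "D \<inter> E"]) auto
    qed
  qed (simp_all add: open' open_set_empty[OF top] open_set_subset[OF top])
  moreover have "projections_continuous J S C T'"
    unfolding projections_continuous_iff[OF e] open'
  proof (intro ballI allI impI conjI)
    fix j A assume j: "j \<in> elts J" and A: "open_set S A"
    show "open_set T {f \<in> elts C. app f j \<in> A}"
      using p[unfolded projections_continuous_iff[OF e]] j A by blast
    fix f assume f: "f \<in> {f \<in> elts C. app f j \<in> A}"
    then obtain D where D: "clopen_set Y S D" "app f j \<in> D" "D \<subseteq> A"
      using Y(2)[unfolded zero_dimensional_iff[OF Y(1)], rule_format, OF A] by blast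
    then show "\<exists>D. clopen_set C T D \<and> f \<in> D \<and> D \<subseteq> {f \<in> elts C. app f j \<in> A}"
      using f power_space_clopen[OF C j D(1)] by (intro exI[of _ "{f \<in> elts C. app f j \<in> D}"]) auto
  qed
  ultimately have "elts T \<subseteq> elts T'" by (rule least)
  then have "open_set T' A" if "open_set T A" for A
    using that by (auto simp: open_set_def)
  then show ?thesis
    unfolding zero_dimensional_iff[OF top] open' by blast
qed

lemma T1_power_space:
  assumes C: "power_space J Y S C T" and Y: "T1_space Y S"
  shows "T1_space C T"
  unfolding T1_space_def
proof (intro ballI impI)
  have e: "elts C = {f. maps f J Y}" and p: "projections_continuous J S C T"
    using C by (auto simp: power_space_def)
  fix f g assume fg: "f \<in> elts C" "g \<in> elts C" "f \<noteq> g"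
  then have m: "maps f J Y" "maps g J Y" by (auto simp: e)
  have "\<exists>j\<in>elts J. app f j \<noteq> app g j"
  proof (rule ccontr)
    assume "\<not> (\<exists>j\<in>elts J. app f j \<noteq> app g j)"
    then have "pair x y \<in> elts f \<longleftrightarrow> pair x y \<in> elts g" for x y
      using pair_in_fun_iff[OF m(1)] pair_in_fun_iff[OF m(2)] by auto
    then have "elts f = elts g" using m unfolding maps_iff by (metis subsetI subset_antisym)
    then show False using fg(3) extensionality by simp
  qed
  then obtain j where j: "j \<in> elts J" "app f j \<noteq> app g j" by blast
  then obtain v where v: "v \<in> elts S" "app f j \<in> elts v" "app g j \<notin> elts v"
    using Y app_in[OF m(1)] app_in[OF m(2)] unfolding T1_space_def by blast
  then have "open_set T {f \<in> elts C. app f j \<in> elts v}"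
    using p[unfolded projections_continuous_iff[OF e]] j by simp
  then show "\<exists>u\<in>elts T. f \<in> elts u \<and> g \<notin> elts u"
    unfolding open_set_def using fg v by auto
qed

text \<open>
  The intersection of all topologies with continuous projections, formed by separation inside the
  discrete topology.
\<close>

lemma power_space_exists: "\<exists>C T. power_space J Y S C T"
proof -
  define P where "P = the_set {p. \<exists>x\<in>elts J. \<exists>y\<in>elts Y. p = pair x y}"
  have P: "elts P = {p. \<exists>x\<in>elts J. \<exists>y\<in>elts Y. p = pair x y}"
    unfolding P_def by (intro elts_the_set is_set_times)
  have "is_set {f. maps f J Y}"
  proof (rule is_set_separation)
    show "{f. maps f J Y} \<subseteq> elts (the_set {f. elts f \<subseteq> elts P})"
      unfolding elts_the_set[OF is_set_Pow] by (auto simp: maps_iff P)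
  qed (intro dfn)
  then obtain C where C: "elts C = {f. maps f J Y}" by (auto simp: is_set_def)
  define good where "good T \<longleftrightarrow> topology_on C T \<and> projections_continuous J S C T" for T
  define T where "T = the_set {u \<in> elts (the_set {u. elts u \<subseteq> elts C}). \<forall>T'. good T' \<longrightarrow> u \<in> elts T'}"
  have "elts T = {u \<in> elts (the_set {u. elts u \<subseteq> elts C}). \<forall>T'. good T' \<longrightarrow> u \<in> elts T'}"
    unfolding T_def good_def projections_continuous_def by (intro elts_the_set is_set_Collect dfn)
  then have T: "elts T = {u. elts u \<subseteq> elts C \<and> (\<forall>T'. good T' \<longrightarrow> u \<in> elts T')}" by simp
  have open_T: "open_set T A \<longleftrightarrow> is_set A \<and> A \<subseteq> elts C \<and> (\<forall>T'. good T' \<longrightarrow> open_set T' A)" for A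
  proof
    assume "open_set T A"
    then show "is_set A \<and> A \<subseteq> elts C \<and> (\<forall>T'. good T' \<longrightarrow> open_set T' A)"
      by (auto simp: open_set_def T)
  next
    assume A: "is_set A \<and> A \<subseteq> elts C \<and> (\<forall>T'. good T' \<longrightarrow> open_set T' A)"
    then obtain a where a: "elts a = A" by (auto simp: is_set_def)
    show "open_set T A" using A by (auto simp: T simp flip: a)
  qed
  have top: "topology_on C T"
  proof (rule topologyI)
    fix S assume S: "elts S \<subseteq> elts T"
    show "open_set T (\<Union>v\<in>elts S. elts v)"
      unfolding open_T
    proof (intro conjI is_set_UN allI impI)
      show "(\<Union>v\<in>elts S. elts v) \<subseteq> elts C" using S by (auto simp: T)
      fix T' assume T': "good T'"
      then have "elts S \<subseteq> elts T'" using S by (auto simp: T)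
      then show "open_set T' (\<Union>v\<in>elts S. elts v)"
        using T' by (intro open_set_Union) (auto simp: good_def)
    qed
  qed (auto simp: open_T good_def open_set_empty open_set_space open_set_Int simp del: open_set_elts)
  have "projections_continuous J S C T"
    unfolding projections_continuous_iff[OF C] open_T
  proof (intro ballI allI impI conjI)
    fix j A assume j: "j \<in> elts J" and A: "open_set S A"
    then obtain a where a: "elts a = A" by (auto simp: open_set_def)
    show "is_set {f \<in> elts C. app f j \<in> A}"
      unfolding a[symmetric] by (intro is_set_Collect dfn)
    show "open_set T' {f \<in> elts C. app f j \<in> A}" if "good T'" for T'
      using that j A unfolding good_def projections_continuous_iff[OF C] by blast
  qed auto
  then have "power_space J Y S C T"
    using C top unfolding power_space_def by (auto simp: T good_def)
  then show ?thesis by blast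
qed

section \<open>Prime ideals from compactness\<close>

lemma binary_operation_val2:
  assumes f: "binary_operation f B" and xy: "x \<in> elts B" "y \<in> elts B"
  shows "val2 f x y = app f (pair x y)" "app f (pair x y) \<in> elts B"
proof -
  obtain P where P: "maps f P B" "elts P = {p. \<exists>x\<in>elts B. \<exists>y\<in>elts B. p = pair x y}"
    using f unfolding binary_operation_def is_pair_iff by auto
  have "pair x y \<in> elts P" using xy by (auto simp: P)
  then show "val2 f x y = app f (pair x y)" "app f (pair x y) \<in> elts B"
    using val_eq[OF P(1)] app_in[OF P(1)] by (simp_all add: val2_def is_pair_iff)
qed

text \<open>
  The hypothesis on \<open>G\<close> does not single out one set for each \<open>a\<close>, and choosing one would be
  illegitimate in the model. But two candidates for the same \<open>a\<close> differ by clopen sets that contain no \<open>h m\<close> with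
  \<open>m\<close> nonzero, and these are small; so they agree at the point \<open>y\<close>, and the ideal can be defined
  with an existential quantifier over all candidates.
\<close>

lemma prime_ideal_from_compact_space:
  assumes alg: "boolean_algebra B join meet compl bt tp"
    and Y: "topology_on Y S" "compact_space Y S"
    and h: "definable_term (\<lambda>e. h (e 0))" "\<And>m. m \<in> elts B \<Longrightarrow> h m \<in> elts Y"
    and G: "\<And>a. a \<in> elts B \<Longrightarrow> \<exists>G. clopen_set Y S G \<and>
      (\<forall>m\<in>elts B. m \<noteq> bt \<longrightarrow> (h m \<in> G \<longleftrightarrow> app meet (pair m a) = m))"
  shows "\<exists>I. prime_ideal I B join meet bt tp"
proof -
  define jn mt cp where "jn x y = app join (pair x y)" and "mt x y = app meet (pair x y)"
    and "cp x = val compl x" for x y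
  have B: "bt \<in> elts B" "tp \<in> elts B" "bt \<noteq> tp"
    using alg by (simp_all add: boolean_algebra_def)
  have op: "binary_operation join B" "binary_operation meet B" "maps compl B B"
    using alg by (simp_all add: boolean_algebra_def)
  have v: "val2 join x y = jn x y" "val2 meet x y = mt x y"
    and cl: "jn x y \<in> elts B" "mt x y \<in> elts B" if "x \<in> elts B" "y \<in> elts B" for x y
    using binary_operation_val2[OF op(1) that] binary_operation_val2[OF op(2) that]
    by (simp_all add: mt_def jn_def)
  have cpB: "cp x \<in> elts B" if "x \<in> elts B" for x
    using val_eq[OF op(3) that] app_in[OF op(3) that] by (simp add: cp_def)
  have eqs:
    "(\<forall>x\<in>elts B. \<forall>y\<in>elts B. val2 join x y = val2 join y x \<and> val2 meet x y = val2 meet y x \<and>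
        val2 join x (val2 meet x y) = x \<and> val2 meet x (val2 join x y) = x) \<longleftrightarrow>
      (\<forall>x\<in>elts B. \<forall>y\<in>elts B. jn x y = jn y x \<and> mt x y = mt y x \<and>
        jn x (mt x y) = x \<and> mt x (jn x y) = x)"
    "(\<forall>x\<in>elts B. \<forall>y\<in>elts B. \<forall>z\<in>elts B. val2 join x (val2 join y z) = val2 join (val2 join x y) z \<and>
        val2 meet x (val2 meet y z) = val2 meet (val2 meet x y) z \<and> val2 meet x (val2 join y z) = val2 join (val2 meet x y) (val2 meet x z) \<and>
        val2 join x (val2 meet y z) = val2 meet (val2 join x y) (val2 join x z)) \<longleftrightarrow>
      (\<forall>x\<in>elts B. \<forall>y\<in>elts B. \<forall>z\<in>elts B. jn x (jn y z) = jn (jn x y) z \<and>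
        mt x (mt y z) = mt (mt x y) z \<and> mt x (jn y z) = jn (mt x y) (mt x z) \<and>
        jn x (mt y z) = mt (jn x y) (jn x z))"
    "(\<forall>x\<in>elts B. val2 join x (cp x) = tp \<and> val2 meet x (cp x) = bt) \<longleftrightarrow>
      (\<forall>x\<in>elts B. jn x (cp x) = tp \<and> mt x (cp x) = bt)"
    by (simp_all only: v cl cpB cong: ball_cong)
  have laws: "(\<forall>x\<in>elts B. \<forall>y\<in>elts B. jn x y = jn y x \<and> mt x y = mt y x \<and>
        jn x (mt x y) = x \<and> mt x (jn x y) = x)"
    "(\<forall>x\<in>elts B. \<forall>y\<in>elts B. \<forall>z\<in>elts B. jn x (jn y z) = jn (jn x y) z \<and>
        mt x (mt y z) = mt (mt x y) z \<and> mt x (jn y z) = jn (mt x y) (mt x z) \<and>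
        jn x (mt y z) = mt (jn x y) (jn x z))"
    "(\<forall>x\<in>elts B. jn x (cp x) = tp \<and> mt x (cp x) = bt)"
    using alg unfolding boolean_algebra_def cp_def[symmetric] eqs by - (elim conjE, assumption)+
  have comm: "jn x y = jn y x" "mt x y = mt y x" and absorb: "jn x (mt x y) = x" "mt x (jn x y) = x"
    if "x \<in> elts B" "y \<in> elts B" for x y
    using laws(1) that by blast+
  have assoc: "mt x (mt y z) = mt (mt x y) z" and distrib: "mt x (jn y z) = jn (mt x y) (mt x z)"
    if "x \<in> elts B" "y \<in> elts B" "z \<in> elts B" for x y z
    using laws(2) that by blast+
  have compl: "jn x (cp x) = tp" "mt x (cp x) = bt" if "x \<in> elts B" for x
    using laws(3) that by blast+
  have idem: "mt x x = x" "jn x x = x" if x: "x \<in> elts B" for x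
    using absorb[OF x cl(1)[OF x x]] absorb[OF x cl(2)[OF x x]] absorb[OF x x] by metis+
  have mt_top: "mt x tp = x" if x: "x \<in> elts B" for x
    using absorb(2)[OF x cpB[OF x]] compl(1)[OF x] by simp
  have mt_bot: "mt x bt = bt" if x: "x \<in> elts B" for x
    using assoc[OF x x cpB[OF x]] compl(2)[OF x] idem[OF x] by simp
  define le where "le x y \<longleftrightarrow> mt x y = x" for x y
  have le_refl: "le x x" if "x \<in> elts B" for x using idem[OF that] by (simp add: le_def)
  have le_trans: "le x z" if "le x y" "le y z" "x \<in> elts B" "y \<in> elts B" "z \<in> elts B" for x y z
    using that assoc[of x y z] by (simp add: le_def)
  have le_mt: "le (mt x y) x" "le (mt x y) y" if xy: "x \<in> elts B" "y \<in> elts B" for x y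
    using assoc[OF xy(1) xy(1) xy(2)] assoc[OF xy xy(2)] assoc[OF xy xy(1)] comm[OF xy] idem xy
    by (simp_all add: le_def)
  have le_bot: "x = bt" if "le x bt" "x \<in> elts B" for x
    using that mt_bot by (simp add: le_def)
  define P where "P = the_set {m \<in> elts B. m \<noteq> bt}"
  have P: "elts P = {m \<in> elts B. m \<noteq> bt}"
    unfolding P_def by (intro elts_the_set is_set_Collect dfn)
  define small where "small v \<longleftrightarrow>
    (\<forall>m\<in>elts P. \<exists>m'\<in>elts P. le m' m \<and> (\<forall>n\<in>elts P. le n m' \<longrightarrow> h n \<notin> elts v))" for v
  have small_dfn: "definable (\<lambda>e. small (e 0))"
    unfolding small_def le_def mt_def by (intro dfn definable_term1[OF h(1)])
  have small_Un: "small w" if u: "small u" and v: "small v" and w: "elts w = elts u \<union> elts v" for u v w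
    unfolding small_def
  proof
    fix m assume m: "m \<in> elts P"
    obtain m' where m': "m' \<in> elts P" "le m' m" "\<forall>n\<in>elts P. le n m' \<longrightarrow> h n \<notin> elts u"
      using u m unfolding small_def by blast
    obtain m'' where m'': "m'' \<in> elts P" "le m'' m'" "\<forall>n\<in>elts P. le n m'' \<longrightarrow> h n \<notin> elts v"
      using v m' unfolding small_def by blast
    have "h n \<notin> elts w" if n: "n \<in> elts P" "le n m''" for n
    proof -
      have "le n m'" using le_trans[OF n(2) m''(2)] n m' m'' by (simp add: P)
      then show ?thesis using n m' m'' w by blast
    qed
    moreover have "le m'' m" using le_trans[OF m''(2) m'(2)] m m' m'' by (simp add: P)
    ultimately show "\<exists>m'\<in>elts P. le m' m \<and> (\<forall>n\<in>elts P. le n m' \<longrightarrow> h n \<notin> elts w)"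
      using m'' by blast
  qed
  have "\<not> small Y"
    using h(2) B le_refl unfolding small_def P by blast
  then obtain y where y: "y \<in> elts Y" "\<And>u. u \<in> elts S \<Longrightarrow> y \<in> elts u \<Longrightarrow> \<not> small u"
  proof -
    have "small z" if "elts z = {}" for z
      using that le_refl by (auto simp: small_def P)
    then show ?thesis
      using compact_ideal[OF Y small_dfn] small_Un \<open>\<not> small Y\<close> that by blast
  qed
  have avoid: "y \<notin> V" if V: "open_set S V" and small: "\<And>m. m \<in> elts P \<Longrightarrow>
      \<exists>m'\<in>elts P. le m' m \<and> (\<forall>n\<in>elts P. le n m' \<longrightarrow> h n \<notin> V)" for V
  proof -
    obtain v where "v \<in> elts S" "elts v = V" using V by (auto simp: open_set_def)
    then show ?thesis using y(2)[of v] small by (auto simp: small_def)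
  qed
  have avoid': "y \<notin> V" if V: "open_set S V" and "\<And>m. m \<in> elts P \<Longrightarrow> h m \<notin> V" for V
    using that le_refl by (intro avoid) (auto simp: P)
  define rep where "rep a V \<longleftrightarrow> clopen_set Y S V \<and> (\<forall>m\<in>elts P. h m \<in> V \<longleftrightarrow> le m a)" for a V
  have rep_unique: "y \<in> V \<longleftrightarrow> y \<in> W" if V: "rep a V" and W: "rep a W" for a V W
  proof -
    have "y \<notin> V - W" if "rep a V" "rep a W" for V W
    proof (rule avoid')
      show "open_set S (V - W)"
        using that clopen_set_Diff[OF Y(1), of V W] by (simp add: rep_def clopen_set_def)
      show "h m \<notin> V - W" if "m \<in> elts P" for m
        using \<open>rep a V\<close> \<open>rep a W\<close> that by (simp add: rep_def)
    qed
    then show ?thesis using V W by blast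
  qed
  define I where "I = the_set {a \<in> elts B. \<exists>u\<in>elts S. clopen_in Y S u \<and>
    (\<forall>m\<in>elts P. h m \<in> elts u \<longleftrightarrow> le m a) \<and> y \<notin> elts u}"
  have I0: "elts I = {a \<in> elts B. \<exists>u\<in>elts S. clopen_in Y S u \<and>
    (\<forall>m\<in>elts P. h m \<in> elts u \<longleftrightarrow> le m a) \<and> y \<notin> elts u}"
    unfolding I_def le_def mt_def by (intro elts_the_set is_set_Collect dfn definable_term1[OF h(1)])
  have I: "a \<in> elts I \<longleftrightarrow> y \<notin> V" if a: "a \<in> elts B" and V: "rep a V" for a V
  proof -
    have "a \<in> elts I \<longleftrightarrow> (\<exists>u\<in>elts S. rep a (elts u) \<and> y \<notin> elts u)"
      using a unfolding I0 rep_def clopen_in_iff by simp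
    also have "\<dots> \<longleftrightarrow> y \<notin> V"
    proof
      assume "\<exists>u\<in>elts S. rep a (elts u) \<and> y \<notin> elts u"
      then show "y \<notin> V" using rep_unique[OF V] by blast
    next
      assume "y \<notin> V"
      moreover obtain v where "v \<in> elts S" "elts v = V"
        using V by (auto simp: rep_def clopen_set_def open_set_def)
      ultimately show "\<exists>u\<in>elts S. rep a (elts u) \<and> y \<notin> elts u" using V by blast
    qed
    finally show ?thesis .
  qed
  \<comment> \<open>This choice is made outside the model, to name a candidate for each \<open>a\<close>; no set is built from \<open>g\<close>.\<close>
  obtain g where g: "\<And>a. a \<in> elts B \<Longrightarrow> rep a (g a)"
  proof -
    have "\<forall>a\<in>elts B. \<exists>V. rep a V"
      using G unfolding rep_def P le_def mt_def Ball_def mem_Collect_eq imp_conjL by blast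
    then show ?thesis using that by metis
  qed
  have g': "clopen_set Y S (g a)" "\<And>m. m \<in> elts P \<Longrightarrow> h m \<in> g a \<longleftrightarrow> le m a" if "a \<in> elts B" for a
    using g[OF that] by (auto simp: rep_def)
  have diff: "open_set S (g a - g b)" if "a \<in> elts B" "b \<in> elts B" for a b
    using clopen_set_Diff[OF Y(1) g'(1) g'(1)] that by (simp add: clopen_set_def)
  have I: "a \<in> elts I \<longleftrightarrow> y \<notin> g a" if "a \<in> elts B" for a
    using I[OF that g[OF that]] .
  have IB: "elts I \<subseteq> elts B" by (auto simp: I0)
  have "prime_ideal I B join meet bt tp"
    unfolding prime_ideal_def
  proof (intro conjI ballI impI IB)
    have "y \<notin> g bt"
      using g' B le_bot by (intro avoid') (auto simp: clopen_set_def P)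
    then show "bt \<in> elts I" using I B by simp
    have "y \<notin> elts Y - g tp"
      using g' B mt_top by (intro avoid') (auto simp: clopen_set_def P le_def)
    then show "tp \<notin> elts I" using I B y(1) by simp
  next
    fix a b assume ab: "a \<in> elts I" "b \<in> elts I"
    have aB: "a \<in> elts B" "b \<in> elts B" "jn a b \<in> elts B"
      using subsetD[OF IB ab(1)] subsetD[OF IB ab(2)] cl by simp_all
    have "y \<notin> g (jn a b) - g a - g b"
    proof (rule avoid)
      have "clopen_set Y S (g (jn a b) - g a - g b)"
        using aB g' clopen_set_Diff[OF Y(1)] by simp
      then show "open_set S (g (jn a b) - g a - g b)" by (simp add: clopen_set_def)
      fix m assume "m \<in> elts P"
      then have m: "m \<in> elts B" "m \<noteq> bt" "m \<in> elts P" by (auto simp: P)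
      have below: "\<exists>m'\<in>elts P. le m' m \<and> (\<forall>n\<in>elts P. le n m' \<longrightarrow> h n \<in> g c)"
        if c: "c \<in> elts B" "mt m c \<noteq> bt" for c
      proof (intro bexI conjI ballI impI)
        show "mt m c \<in> elts P" "le (mt m c) m" using c m cl le_mt by (auto simp: P)
        fix n assume n: "n \<in> elts P" "le n (mt m c)"
        then have "le n c" using le_trans[OF n(2) le_mt(2)] m c cl by (auto simp: P)
        then show "h n \<in> g c" using g' n c by blast
      qed
      \<comment> \<open>Below \<open>m \<sqinter> a\<close> all points are in \<open>g a\<close>, below \<open>m \<sqinter> b\<close> in \<open>g b\<close>. If both meets vanish, then
        nothing nonzero below \<open>m\<close> is below \<open>a \<squnion> b\<close>, and \<open>m\<close> itself will do.\<close>
      show "\<exists>m'\<in>elts P. le m' m \<and> (\<forall>n\<in>elts P. le n m' \<longrightarrow> h n \<notin> g (jn a b) - g a - g b)"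
      proof (cases "mt m a = bt \<and> mt m b = bt")
        case False
        then show ?thesis using below[OF aB(1)] below[OF aB(2)] by blast
      next
        case True
        have "\<not> le n (jn a b)" if n: "n \<in> elts P" "le n m" for n
        proof
          assume le: "le n (jn a b)"
          have nB: "n \<in> elts B" "n \<noteq> bt" using n by (auto simp: P)
          have bot: "mt n c = bt" if "c \<in> elts B" "mt m c = bt" for c
            using assoc[OF nB(1) m(1) that(1)] that n(2) mt_bot[OF nB(1)] by (simp add: le_def)
          have "n = jn (mt n a) (mt n b)" using le distrib[OF nB(1) aB(1,2)] by (simp add: le_def)
          also have "\<dots> = bt" using bot True aB idem B by simp
          finally show False using nB by simp
        qed
        then show ?thesis using m le_refl g'(2)[OF aB(3)] by blast
      qed
    qed
    then show "val2 join a b \<in> elts I" using ab aB I by (simp add: v)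
  next
    fix a b assume ab: "a \<in> elts I" "b \<in> elts B" "val2 meet a b = b"
    then have aB: "a \<in> elts B" "b \<in> elts B" using IB by auto
    then have "le b a" using ab(3) comm(2)[OF aB] by (simp add: v le_def)
    have "y \<notin> g b - g a"
      using diff aB g' le_trans[OF _ \<open>le b a\<close>] by (intro avoid') (auto simp: P)
    then show "b \<in> elts I" using ab aB I by simp
  next
    fix a b assume ab: "a \<in> elts B" "b \<in> elts B" "val2 meet a b \<in> elts I"
    have "y \<notin> g a \<inter> g b - g (mt a b)"
    proof (rule avoid')
      have "clopen_set Y S (g a \<inter> g b - g (mt a b))"
        using ab g' cl clopen_set_Diff[OF Y(1)] clopen_set_Int[OF Y(1)] by simp
      then show "open_set S (g a \<inter> g b - g (mt a b))" by (simp add: clopen_set_def)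
      fix m assume m: "m \<in> elts P"
      have "le m (mt a b)" if "le m a" "le m b"
        using that assoc[of m a b] ab m by (simp add: le_def P)
      then show "h m \<notin> g a \<inter> g b - g (mt a b)" using g'(2)[OF _ m] ab cl by auto
    qed
    then show "a \<in> elts I \<or> b \<in> elts I" using ab I cl by (auto simp: v)
  qed
  then show ?thesis by blast
qed

text \<open>
  Extend the characteristic function of \<open>A\<close>, a map into the compact discrete space with two points.
\<close>

lemma banaschewski_clopen:
  assumes b: "banaschewski_compactification X T Y S b" and X: "topology_on X T" and A: "clopen_set X T A"
  shows "\<exists>G. clopen_set Y S G \<and> (\<forall>x\<in>elts X. app b x \<in> G \<longleftrightarrow> x \<in> A)"
proof -
  obtain a where a: "elts a = A" using A by (auto simp: clopen_set_def open_set_def)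
  have mb: "maps b X Y"
    using b by (simp add: banaschewski_compactification_def compactification_def embedding_def continuous_def)
  define F where "F x = (if x \<in> elts a then one else zero)" for x
  have F: "definable_term (\<lambda>e. F (e 0))" unfolding F_def by (intro dfn)
  define f where "f = mkfun X F"
  have f: "maps f X two" unfolding f_def by (intro maps_mkfun[OF F]) (simp add: F_def elts_two)
  have app_f: "app f x = (if x \<in> A then one else zero)" if "x \<in> elts X" for x
    unfolding f_def app_mkfun[OF F that] by (simp add: F_def a)
  have "continuous X T two two_topology f"
    unfolding continuous_iff
  proof (intro conjI f allI impI)
    fix V assume "open_set two_topology V"
    have "{x \<in> elts X. app f x \<in> V} = (if one \<in> V then A else {}) \<union> (if zero \<in> V then elts X - A else {})"
      using A by (auto simp: app_f clopen_set_def split: if_splits)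
    also have "open_set T \<dots>"
      using A open_set_empty[OF X] by (intro open_set_Un[OF X]) (auto simp: clopen_set_def)
    finally show "open_set T {x \<in> elts X. app f x \<in> V}" .
  qed
  then obtain g where g: "continuous Y S two two_topology g" "graph_of b O graph_of g = graph_of f"
    using b topology_discrete[OF discrete_two] compact_two zero_dimensional_discrete[OF discrete_two]
      T1_discrete[OF discrete_two] unfolding banaschewski_compactification_def by blast
  have mg: "maps g Y two" using g by (simp add: continuous_def)
  have "clopen_set two two_topology {one}"
    by (simp add: clopen_discrete_iff[OF discrete_two] elts_two)
  from continuous_clopen_preimage[OF g(1) this]
  have "clopen_set Y S {p \<in> elts Y. app g p \<in> {one}}" .
  moreover have "app b x \<in> {p \<in> elts Y. app g p \<in> {one}} \<longleftrightarrow> x \<in> A" if "x \<in> elts X" for x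
    using that g(2) app_in[OF mb that] zero_neq_one
    by (simp add: graph_of_comp_eq_iff[OF mb mg f] app_f)
  ultimately show ?thesis by blast
qed

text \<open>
  The points are those of \<open>B\<close>, placed inside an infinite set \<open>J\<close>. The principal ideal of \<open>a\<close>, like any
  subset of \<open>J\<close>, is clopen.
\<close>

lemma BPI_if_discrete:
  assumes "\<And>X T. \<not> finite_set X \<Longrightarrow> discrete_topology X T \<Longrightarrow> has_banaschewski X T"
  shows BPI
  unfolding BPI_def
proof (intro allI impI)
  fix B join meet compl bt tp assume alg: "boolean_algebra B join meet compl bt tp"
  obtain J where J: "elts B \<subseteq> elts J" "\<not> finite_set J" using infinite_superset_exists by blast
  define T where "T = the_set {u. elts u \<subseteq> elts J}"
  have T: "discrete_topology J T" by (simp add: T_def discrete_topology_def)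
  obtain Y S b where b: "banaschewski_compactification J T Y S b"
    using assms[OF J(2) T] by (auto simp: has_banaschewski_def)
  then have Y: "topology_on Y S" "compact_space Y S" "maps b J Y"
    by (simp_all add: banaschewski_compactification_def compactification_def embedding_def continuous_def)
  show "\<exists>I. prime_ideal I B join meet bt tp"
  proof (rule prime_ideal_from_compact_space[OF alg Y(1,2), of "app b"])
    show "definable_term (\<lambda>e. app b (e 0))" by (intro dfn)
    show "app b m \<in> elts Y" if "m \<in> elts B" for m using app_in[OF Y(3)] that J by blast
    fix a assume a: "a \<in> elts B"
    define A where "A = {m \<in> elts B. app meet (pair m a) = m}"
    have "is_set A" unfolding A_def by (intro is_set_Collect dfn)
    then have "clopen_set J T A"
      unfolding clopen_discrete_iff[OF T] using J by (auto simp: A_def)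
    then obtain G where "clopen_set Y S G" "\<forall>x\<in>elts J. app b x \<in> G \<longleftrightarrow> x \<in> A"
      using banaschewski_clopen[OF b topology_discrete[OF T]] by blast
    then show "\<exists>G. clopen_set Y S G \<and>
        (\<forall>m\<in>elts B. m \<noteq> bt \<longrightarrow> (app b m \<in> G \<longleftrightarrow> app meet (pair m a) = m))"
      using J by (intro exI[of _ G]) (auto simp: A_def)
  qed
qed

text \<open>
  An element \<open>m\<close> is represented by the characteristic function of \<open>{a \<in> B. m \<le> a}\<close>, extended by
  \<open>0\<close> to an infinite index set \<open>J\<close>. The condition \<open>m \<le> a\<close> is then visible at coordinate \<open>a\<close>.
\<close>

lemma BPI_if_cantor_cube:
  assumes "\<And>J C T. \<not> finite_set J \<Longrightarrow> cantor_cube J C T \<Longrightarrow> has_banaschewski C T"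
  shows BPI
  unfolding BPI_def
proof (intro allI impI)
  fix B join meet compl bt tp assume alg: "boolean_algebra B join meet compl bt tp"
  obtain J where J: "elts B \<subseteq> elts J" "\<not> finite_set J" using infinite_superset_exists by blast
  obtain C T where pow: "power_space J two two_topology C T" using power_space_exists by blast
  then have C: "elts C = {f. maps f J two}" "topology_on C T" by (simp_all add: power_space_def)
  have "cantor_cube J C T"
    unfolding cantor_cube_def using is_two_two discrete_two pow by blast
  then obtain Y S b where b: "banaschewski_compactification C T Y S b"
    using assms[OF J(2)] unfolding has_banaschewski_def by blast
  then have Y: "topology_on Y S" "compact_space Y S" "maps b C Y"
    by (simp_all add: banaschewski_compactification_def compactification_def embedding_def continuous_def)
  define F where "F m j = (if j \<in> elts B \<and> app meet (pair m j) = m then one else zero)" for m j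
  have F: "definable_term (\<lambda>e. F m (e 0))" for m unfolding F_def by (intro dfn)
  define chr where "chr m = mkfun J (F m)" for m
  have chr: "chr m \<in> elts C" for m
    unfolding chr_def C mem_Collect_eq by (intro maps_mkfun[OF F]) (simp add: F_def elts_two)
  have app_chr: "app (chr m) j = F m j" if "j \<in> elts J" for m j
    unfolding chr_def by (rule app_mkfun[OF F that])
  have chr_dfn: "definable_term (\<lambda>e. chr (e 0))"
    unfolding chr_def mkfun_def image_def F_def by (intro dfn)
  show "\<exists>I. prime_ideal I B join meet bt tp"
  proof (rule prime_ideal_from_compact_space[OF alg Y(1,2), of "\<lambda>m. app b (chr m)"])
    show "definable_term (\<lambda>e. app b (chr (e 0)))" by (intro dfn definable_term1[OF chr_dfn])
    show "app b (chr m) \<in> elts Y" for m using app_in[OF Y(3) chr] .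
    fix a assume a: "a \<in> elts B"
    then have aJ: "a \<in> elts J" using J by blast
    have "clopen_set two two_topology {one}"
      by (simp add: clopen_discrete_iff[OF discrete_two] elts_two)
    then have "clopen_set C T {f \<in> elts C. app f a \<in> {one}}"
      by (rule power_space_clopen[OF pow aJ])
    then obtain G where G: "clopen_set Y S G"
      "\<forall>f\<in>elts C. app b f \<in> G \<longleftrightarrow> f \<in> {f \<in> elts C. app f a \<in> {one}}"
      using banaschewski_clopen[OF b C(2)] by blast
    then have "app b (chr m) \<in> G \<longleftrightarrow> app meet (pair m a) = m" for m
      using chr[of m] a zero_neq_one by (simp add: app_chr[OF aJ] F_def)
    then show "\<exists>G. clopen_set Y S G \<and>
        (\<forall>m\<in>elts B. m \<noteq> bt \<longrightarrow> (app b (chr m) \<in> G \<longleftrightarrow> app meet (pair m a) = m))"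
      using G(1) by blast
  qed
qed

end

section \<open>The equivalences\<close>

theorem theorem2p4:
  fixes M :: "'a \<Rightarrow> 'a \<Rightarrow> bool"
  assumes "ZF_model M"
  shows
    "(membership.BPI M \<longleftrightarrow>
        (\<forall>X T. membership.topology_on M X T \<and> membership.zero_dimensional M X T \<and>
           membership.T1_space M X T \<longrightarrow> membership.has_banaschewski M X T)) \<and>
     (membership.BPI M \<longleftrightarrow>
        (\<forall>J C T. \<not> membership.finite_set M J \<and> membership.cantor_cube M J C T \<longrightarrow>
           membership.has_banaschewski M C T)) \<and>
     (membership.BPI M \<longleftrightarrow>
        (\<forall>X T. \<not> membership.finite_set M X \<and> membership.discrete_topology M X T \<longrightarrow>
           membership.has_banaschewski M X T))"
proof -
  interpret ZF_model M by fact
  have zero_dim: "has_banaschewski X T"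
    if "BPI" "topology_on X T" "zero_dimensional X T" "T1_space X T" for X T
    unfolding has_banaschewski_def using banaschewski_stone[OF that(2-4,1)] by blast
  have cube: "has_banaschewski C T" if bpi: "BPI" and C: "cantor_cube J C T" for J C T
  proof -
    obtain t D where D: "discrete_topology t D" "power_space J t D C T"
      using C unfolding cantor_cube_def by blast
    have "topology_on C T" using D(2) by (simp add: power_space_def)
    then show ?thesis
      using zero_dim[OF bpi] T1_power_space[OF D(2) T1_discrete[OF D(1)]]
        zero_dimensional_power_space[OF D(2) topology_discrete[OF D(1)] zero_dimensional_discrete[OF D(1)]]
      by blast
  qed
  have discrete: "has_banaschewski X T" if "BPI" "discrete_topology X T" for X T
    using zero_dim[OF that(1) topology_discrete zero_dimensional_discrete T1_discrete] that(2) by blast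
  show ?thesis
  proof (intro conjI iffI allI impI; (elim conjE)?)
    assume "\<forall>X T. topology_on X T \<and> zero_dimensional X T \<and> T1_space X T \<longrightarrow> has_banaschewski X T"
    then show BPI
      using topology_discrete zero_dimensional_discrete T1_discrete
      by (intro BPI_if_discrete) blast
  next
    assume "\<forall>J C T. \<not> finite_set J \<and> cantor_cube J C T \<longrightarrow> has_banaschewski C T"
    then show BPI by (intro BPI_if_cantor_cube) blast
  next
    assume "\<forall>X T. \<not> finite_set X \<and> discrete_topology X T \<longrightarrow> has_banaschewski X T"
    then show BPI by (intro BPI_if_discrete) blast
  qed (blast intro: zero_dim cube discrete)+
qed

end
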